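(* Let $\Bbbk$ be an algebraically closed field of characteristic zero, let $G=\mathbb{Z}_{m_1}\times\cdots\times\mathbb{Z}_{m_n}$ with $m_i\mid m_{i+1}$ for $1\le i\le n-1$, and let $(K_\bullet,d_\bullet)$ be the Koszul-like free resolution of the trivial $\mathbb{Z}G$-module $\mathbb{Z}$ defined in the context. Let $k\ge 1$. Then the set of all $f\in \operatorname{Hom}_{\mathbb{Z}G}(K_k,\Bbbk^* )$ such that, for all $l\geq 1$, all $1\le r_1<\cdots<r_l\le n$ and all integers $\lambda_1,\dots,\lambda_l\ge 1$ with $\lambda_1+\cdots+\lambda_l=k$, $$f_{r_1^{\lambda_1}\cdots r_l^{\lambda_l}}=1\ \text{ if }\lambda_1\text{ is even},\qquad f_{r_1^{\lambda_1}\cdots r_l^{\lambda_l}}=\zeta_{m_{r_1}}^{a_{r_1^{\lambda_1}\cdots r_l^{\lambda_l}}}\ \text{ for some integer }0\le a_{r_1^{\lambda_1}\cdots r_l^{\lambda_l}}<m_{r_1}\ \text{ if }\lambda_1\text{ is odd},$$ is a complete set of representatives of $k$-cocycles of the complex $(K_\bullet^*,d_\bullet^* )=\operatorname{Hom}_{\mathbb{Z}G}(K_\bullet,\Bbbk^* )$; that is, every such $f$ is a $k$-cocycle, and every $k$-cocycle is cohomologous to exactly one such $f$.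
   Context: $\Bbbk^*=\Bbbk\setminus\{0\}$ is the multiplicative group, with trivial $G$-action. $\zeta_m$ denotes a fixed primitive $m$-th root of unity in $\Bbbk$. For each $i$ fix a generator $g_i$ of the factor $\mathbb{Z}_{m_i}$ (written multiplicatively), and put $T_i=g_i-1$, $N_i=\sum_{j=0}^{m_i-1}g_i^j$ in $\mathbb{Z}G$. The complex $(K_\bullet,d_\bullet)$: for each sequence $a_1,\dots,a_n$ of nonnegative integers let $\Phi(a_1,\dots,a_n)$ be a free generator in degree $a_1+\cdots+a_n$, and $K_m=\bigoplus_{a_1+\cdots+a_n=m}(\mathbb{Z}G)\Phi(a_1,\dots,a_n)$. The differential is $d=d_1+\cdots+d_n$, where $d_i(\Phi(a_1,\dots,a_n))$ equals $0$ if $a_i=0$; equals $(-1)^{\sum_{l<i}a_l}N_i\Phi(a_1,\dots,a_i-1,\dots,a_n)$ if $a_i\neq 0$ is even; and equals $(-1)^{\sum_{l<i}a_l}T_i\Phi(a_1,\dots,a_i-1,\dots,a_n)$ if $a_i$ is odd. This is a free resolution of $\mathbb{Z}$ (with the augmentation $K_0=\mathbb{Z}G\to\mathbb{Z}$). For $1\le r_1<\cdots<r_l\le n$ and $\lambda_i\ge 1$, $\Phi_{r_1^{\lambda_1}\cdots r_l^{\lambda_l}}$ denotes $\Phi(0,\dots,\lambda_1,\dots,\lambda_l,\dots,0)$ with $\lambda_i$ in position $r_i$ and $0$ elsewhere. For $f\in\operatorname{Hom}_{\mathbb{Z}G}(K_k,\Bbbk^* )$, write $f_{r_1^{\lambda_1}\cdots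 r_l^{\lambda_l}}=f(\Phi_{r_1^{\lambda_1}\cdots r_l^{\lambda_l}})$; these values determine $f$. The differential $d^*$ is precomposition with $d$. *)

theory Defs
  imports "HOL-Algebra.Algebra" "HOL-Algebra.Product_Groups" "HOL-Algebra.Elementary_Groups"
    "HOL-Computational_Algebra.Polynomial"
begin

subsection \<open>Finite abelian groups and integral group rings\<close>

definition cyclic_product :: "nat \<Rightarrow> (nat \<Rightarrow> nat) \<Rightarrow> (nat \<Rightarrow> int) monoid" where
  "cyclic_product n m = product_group {1..n} (\<lambda>i. integer_mod_group (m i))"

text \<open>The element of the product with entry \<open>\<gamma> i\<close> in the factor \<open>i\<close> and the identity elsewhere.\<close>

definition factor_elt :: "nat \<Rightarrow> (nat \<Rightarrow> nat) \<Rightarrow> (nat \<Rightarrow> int) \<Rightarrow> nat \<Rightarrow> (nat \<Rightarrow> int)" where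
  "factor_elt n m \<gamma> i =
     (\<lambda>j\<in>{1..n}. if j = i then \<gamma> i else \<one>\<^bsub>integer_mod_group (m j)\<^esub>)"

definition group_ring :: "('g, 'x) monoid_scheme \<Rightarrow> ('g \<Rightarrow> int) ring" where
  "group_ring G =
     \<lparr>carrier = {r. finite {x. r x \<noteq> 0} \<and> {x. r x \<noteq> 0} \<subseteq> carrier G},
      monoid.mult = (\<lambda>r s x. \<Sum>y | r y \<noteq> 0. \<Sum>z | s z \<noteq> 0 \<and> y \<otimes>\<^bsub>G\<^esub> z = x. r y * s z),
      monoid.one = (\<lambda>x. if x = \<one>\<^bsub>G\<^esub> then 1 else 0),
      ring.zero = (\<lambda>x. 0),
      ring.add = (\<lambda>r s x. r x + s x)\<rparr>"

definition group_ring_of :: "'g \<Rightarrow> ('g \<Rightarrow> int)" where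
  "group_ring_of g = (\<lambda>x. if x = g then 1 else 0)"

definition T_elt :: "('g, 'x) monoid_scheme \<Rightarrow> 'g \<Rightarrow> ('g \<Rightarrow> int)" where
  "T_elt G g = group_ring_of g \<ominus>\<^bsub>group_ring G\<^esub> \<one>\<^bsub>group_ring G\<^esub>"

definition N_elt :: "('g, 'x) monoid_scheme \<Rightarrow> nat \<Rightarrow> 'g \<Rightarrow> ('g \<Rightarrow> int)" where
  "N_elt G q g = (\<Oplus>\<^bsub>group_ring G\<^esub>j\<in>{..<q}. group_ring_of (g [^]\<^bsub>G\<^esub> j))"

subsection \<open>The Koszul-like complex\<close>

text \<open>A sequence \<open>(a\<^sub>1, \<dots>, a\<^sub>n)\<close> is a function vanishing outside \<open>{1..n}\<close>.\<close>

definition exponents :: "nat \<Rightarrow> nat \<Rightarrow> (nat \<Rightarrow> nat) set" where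
  "exponents n k = {a. (\<forall>j. j \<notin> {1..n} \<longrightarrow> a j = 0) \<and> (\<Sum>j=1..n. a j) = k}"

text \<open>An element of the free module is its coordinate family; no finiteness condition is
  needed because \<open>exponents n k\<close> is finite. In the records for modules the ring
  multiplication fields carry no meaning.\<close>

definition koszul_module ::
  "('g, 'x) monoid_scheme \<Rightarrow> nat \<Rightarrow> nat \<Rightarrow> ('g \<Rightarrow> int, (nat \<Rightarrow> nat) \<Rightarrow> ('g \<Rightarrow> int)) module" where
  "koszul_module G n k =
     \<lparr>carrier = {c. (\<forall>a. c a \<in> carrier (group_ring G)) \<and>
                    (\<forall>a. a \<notin> exponents n k \<longrightarrow> c a = \<zero>\<^bsub>group_ring G\<^esub>)},
      monoid.mult = undefined,
      monoid.one = undefined,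
      ring.zero = (\<lambda>a. \<zero>\<^bsub>group_ring G\<^esub>),
      ring.add = (\<lambda>c d a. c a \<oplus>\<^bsub>group_ring G\<^esub> d a),
      module.smult = (\<lambda>r c a. r \<otimes>\<^bsub>group_ring G\<^esub> c a)\<rparr>"

definition Phi ::
  "('g, 'x) monoid_scheme \<Rightarrow> (nat \<Rightarrow> nat) \<Rightarrow> ((nat \<Rightarrow> nat) \<Rightarrow> ('g \<Rightarrow> int))" where
  "Phi G a = (\<lambda>b. if b = a then \<one>\<^bsub>group_ring G\<^esub> else \<zero>\<^bsub>group_ring G\<^esub>)"

definition koszul_diff_gen ::
  "('g, 'x) monoid_scheme \<Rightarrow> nat \<Rightarrow> (nat \<Rightarrow> nat) \<Rightarrow> (nat \<Rightarrow> 'g) \<Rightarrow> nat \<Rightarrow> nat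
     \<Rightarrow> (nat \<Rightarrow> nat) \<Rightarrow> ((nat \<Rightarrow> nat) \<Rightarrow> ('g \<Rightarrow> int))" where
  "koszul_diff_gen G n m g k i a =
     (if a i = 0 then \<zero>\<^bsub>koszul_module G n (k - 1)\<^esub>
      else ((\<ominus>\<^bsub>group_ring G\<^esub> \<one>\<^bsub>group_ring G\<^esub>) [^]\<^bsub>group_ring G\<^esub> (\<Sum>l=1..<i. a l)
              \<otimes>\<^bsub>group_ring G\<^esub> (if even (a i) then N_elt G (m i) (g i) else T_elt G (g i)))
           \<odot>\<^bsub>koszul_module G n (k - 1)\<^esub> Phi G (a(i := a i - 1)))"

text \<open>The differential from degree \<open>k\<close> to degree \<open>k - 1\<close>, extended linearly from the
  generators. In degree \<open>0\<close> it is the zero map, since then all \<open>a i\<close> vanish.\<close>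

definition koszul_diff ::
  "('g, 'x) monoid_scheme \<Rightarrow> nat \<Rightarrow> (nat \<Rightarrow> nat) \<Rightarrow> (nat \<Rightarrow> 'g) \<Rightarrow> nat
     \<Rightarrow> ((nat \<Rightarrow> nat) \<Rightarrow> ('g \<Rightarrow> int)) \<Rightarrow> ((nat \<Rightarrow> nat) \<Rightarrow> ('g \<Rightarrow> int))" where
  "koszul_diff G n m g k c =
     (\<Oplus>\<^bsub>koszul_module G n (k - 1)\<^esub>a\<in>exponents n k.
        c a \<odot>\<^bsub>koszul_module G n (k - 1)\<^esub>
          (\<Oplus>\<^bsub>koszul_module G n (k - 1)\<^esub>i\<in>{1..n}. koszul_diff_gen G n m g k i a))"

subsection \<open>Cochains with values in the multiplicative group of a field\<close>

text \<open>The multiplicative group with trivial action, as a module over the group ring. Its module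
  addition is the multiplication of the field, so a group ring element
  \<open>r = (\<Sum>g. r g * g)\<close> sends \<open>x\<close> to the product of the powers \<open>(g x)^(r g) = x^(r g)\<close>.\<close>

definition units_module :: "('g \<Rightarrow> int, 'k::field) module" where
  "units_module =
     \<lparr>carrier = {x. x \<noteq> 0},
      monoid.mult = undefined,
      monoid.one = undefined,
      ring.zero = 1,
      ring.add = (*),
      module.smult = (\<lambda>r x. \<Prod>g | r g \<noteq> 0. x powi r g)\<rparr>"

text \<open>Homomorphisms are taken extensional (value \<open>undefined\<close> off the carrier), so that equality
  of homomorphisms is equality of functions.\<close>

definition module_Hom ::
  "('r, 'x) ring_scheme \<Rightarrow> ('r, 'a, 'y) module_scheme \<Rightarrow> ('r, 'b, 'z) module_scheme \<Rightarrow> ('a \<Rightarrow> 'b) set" where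
  "module_Hom R M N =
     {f \<in> carrier M \<rightarrow>\<^sub>E carrier N.
        (\<forall>x\<in>carrier M. \<forall>y\<in>carrier M. f (x \<oplus>\<^bsub>M\<^esub> y) = f x \<oplus>\<^bsub>N\<^esub> f y) \<and>
        (\<forall>r\<in>carrier R. \<forall>x\<in>carrier M. f (r \<odot>\<^bsub>M\<^esub> x) = r \<odot>\<^bsub>N\<^esub> f x)}"

definition cochains ::
  "('g, 'x) monoid_scheme \<Rightarrow> nat \<Rightarrow> nat \<Rightarrow> (((nat \<Rightarrow> nat) \<Rightarrow> ('g \<Rightarrow> int)) \<Rightarrow> 'k::field) set" where
  "cochains G n k = module_Hom (group_ring G) (koszul_module G n k) units_module"

text \<open>\<open>codiff G n m g k\<close> maps \<open>(k - 1)\<close>-cochains to \<open>k\<close>-cochains.\<close>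

definition codiff ::
  "('g, 'x) monoid_scheme \<Rightarrow> nat \<Rightarrow> (nat \<Rightarrow> nat) \<Rightarrow> (nat \<Rightarrow> 'g) \<Rightarrow> nat
     \<Rightarrow> (((nat \<Rightarrow> nat) \<Rightarrow> ('g \<Rightarrow> int)) \<Rightarrow> 'k::field)
     \<Rightarrow> (((nat \<Rightarrow> nat) \<Rightarrow> ('g \<Rightarrow> int)) \<Rightarrow> 'k)" where
  "codiff G n m g k f = (\<lambda>c\<in>carrier (koszul_module G n k). f (koszul_diff G n m g k c))"

definition cocycles ::
  "('g, 'x) monoid_scheme \<Rightarrow> nat \<Rightarrow> (nat \<Rightarrow> nat) \<Rightarrow> (nat \<Rightarrow> 'g) \<Rightarrow> nat
     \<Rightarrow> (((nat \<Rightarrow> nat) \<Rightarrow> ('g \<Rightarrow> int)) \<Rightarrow> 'k::field) set" where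
  "cocycles G n m g k =
     {f \<in> cochains G n k.
        codiff G n m g (k + 1) f = (\<lambda>c\<in>carrier (koszul_module G n (k + 1)). 1)}"

definition coboundaries ::
  "('g, 'x) monoid_scheme \<Rightarrow> nat \<Rightarrow> (nat \<Rightarrow> nat) \<Rightarrow> (nat \<Rightarrow> 'g) \<Rightarrow> nat
     \<Rightarrow> (((nat \<Rightarrow> nat) \<Rightarrow> ('g \<Rightarrow> int)) \<Rightarrow> 'k::field) set" where
  "coboundaries G n m g k = codiff G n m g k ` cochains G n (k - 1)"

definition cohomologous ::
  "('g, 'x) monoid_scheme \<Rightarrow> nat \<Rightarrow> (nat \<Rightarrow> nat) \<Rightarrow> (nat \<Rightarrow> 'g) \<Rightarrow> nat
     \<Rightarrow> (((nat \<Rightarrow> nat) \<Rightarrow> ('g \<Rightarrow> int)) \<Rightarrow> 'k::field)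
     \<Rightarrow> (((nat \<Rightarrow> nat) \<Rightarrow> ('g \<Rightarrow> int)) \<Rightarrow> 'k) \<Rightarrow> bool" where
  "cohomologous G n m g k f f' \<longleftrightarrow>
     (\<lambda>c\<in>carrier (koszul_module G n k). f c / f' c) \<in> coboundaries G n m g k"

subsection \<open>Normalized cochains\<close>

definition primitive_root_of_unity :: "nat \<Rightarrow> 'k::field \<Rightarrow> bool" where
  "primitive_root_of_unity q z \<longleftrightarrow> 0 < q \<and> z ^ q = 1 \<and> (\<forall>j. 0 < j \<and> j < q \<longrightarrow> z ^ j \<noteq> 1)"

text \<open>The sequence with entry \<open>\<lambda>\<^sub>i\<close> in position \<open>r\<^sub>i\<close> for \<open>1 \<le> i \<le> l\<close> and \<open>0\<close> elsewhere; for
  \<open>r\<close> injective on \<open>{1..l}\<close> the sum has at most one term.\<close>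

definition power_exponents :: "nat \<Rightarrow> (nat \<Rightarrow> nat) \<Rightarrow> (nat \<Rightarrow> nat) \<Rightarrow> (nat \<Rightarrow> nat)" where
  "power_exponents l r lam = (\<lambda>j. \<Sum>i | i \<in> {1..l} \<and> r i = j. lam i)"

definition normalized_cochains ::
  "('g, 'x) monoid_scheme \<Rightarrow> nat \<Rightarrow> (nat \<Rightarrow> nat) \<Rightarrow> (nat \<Rightarrow> 'k::field) \<Rightarrow> nat
     \<Rightarrow> (((nat \<Rightarrow> nat) \<Rightarrow> ('g \<Rightarrow> int)) \<Rightarrow> 'k) set" where
  "normalized_cochains G n m \<zeta> k =
     {f \<in> cochains G n k.
        \<forall>l r lam. 1 \<le> l \<and> strict_mono_on {1..l} r \<and> r ` {1..l} \<subseteq> {1..n} \<and>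
            (\<forall>i\<in>{1..l}. 1 \<le> lam i) \<and> (\<Sum>i=1..l. lam i) = k \<longrightarrow>
          (even (lam 1) \<longrightarrow> f (Phi G (power_exponents l r lam)) = 1) \<and>
          (odd (lam 1) \<longrightarrow>
             (\<exists>e::nat. e < m (r 1) \<and> f (Phi G (power_exponents l r lam)) = \<zeta> (m (r 1)) ^ e))}"

definition complete_set_of_representatives :: "'a set \<Rightarrow> 'a set \<Rightarrow> ('a \<Rightarrow> 'a \<Rightarrow> bool) \<Rightarrow> bool" where
  "complete_set_of_representatives S Z equivalent \<longleftrightarrow>
     S \<subseteq> Z \<and> (\<forall>f\<in>Z. \<exists>!f'. f' \<in> S \<and> equivalent f f')"

end

theory Submission
  imports Defs
begin

text \<open>
  Since \<open>G\<close> acts trivially on the multiplicative group of the field, a group ring element acts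
  there by the power whose exponent is its augmentation. Hence \<open>T\<^sub>i\<close> acts trivially, \<open>N\<^sub>i\<close> acts as
  the power \<open>m\<^sub>i\<close>, and a \<open>k\<close>-cochain is an arbitrary family of nonzero values \<open>F a\<close>, indexed by the
  exponent sequences \<open>a\<close> of degree \<open>k\<close>. In these terms (\<open>codiff_eq_cochain_of\<close>) the codifferential
  is \<open>(D F) b = \<Prod>\<^sub>i (F (b - e\<^sub>i)) ^ (\<plusminus> m\<^sub>i)\<close>, where \<open>e\<^sub>i\<close> is the \<open>i\<close>-th unit vector, \<open>i\<close> runs over the
  positions with \<open>b\<^sub>i\<close> even and positive, and the sign is that of the Koszul complex.

  Call the first nonzero position \<open>p\<close> of \<open>a\<close> its leading position. If \<open>F\<close> is trivial at all
  sequences with an even leading entry, then every factor of \<open>(D F) (a + e\<^sub>p)\<close> with \<open>i \<noteq> p\<close> is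
  trivial when \<open>a\<^sub>p\<close> is odd, so that this value is just \<open>(F a) ^ m\<^sub>p\<close>. Three facts follow.

  \<^item> Extracting roots, which is where algebraic closedness enters, gives for any \<open>F\<close> a family \<open>L\<close>
    such that \<open>D L\<close> and \<open>F\<close> agree at even leading entries
    (\<open>coboundary_prescribed_at_even_leads\<close>).
  \<^item> If \<open>F\<close> is trivial at even leading entries and so is \<open>D F\<close>, then \<open>(F a) ^ m\<^sub>p = 1\<close> for all \<open>a\<close>
    with leading position \<open>p\<close> (\<open>torsion_of_even_lead_coboundary\<close>).
  \<^item> Conversely these equations force \<open>D F = 1\<close>, because \<open>b - e\<^sub>i\<close> has the same leading position
    \<open>p \<le> i\<close> as \<open>b\<close>, and \<open>m\<^sub>p\<close> divides \<open>m\<^sub>i\<close> (\<open>coboundary_values_torsion\<close>).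

  The normalized cochains are exactly the families that are trivial at even leading entries and
  satisfy \<open>(F a) ^ m\<^sub>p = 1\<close> (\<open>normalized_cochains_iff\<close>). By the third fact they are cocycles. A
  cocycle \<open>F\<close> is cohomologous to \<open>F / D L\<close>, with \<open>L\<close> as in the first fact; as \<open>D (D L) = 1\<close>, this quotient is
  again a cocycle, and it is normalized by the second fact. For uniqueness, the quotient of two
  cohomologous normalized cochains is a coboundary \<open>D H\<close> that is trivial at even leading entries.
  With \<open>L\<close> chosen for \<open>H\<close>, the family \<open>H' = H / D L\<close> has \<open>D H' = D H\<close> and is trivial at even leading
  entries; the second fact makes it torsion and the third gives \<open>D H = D H' = 1\<close>
  (\<open>coboundary_trivial_if_trivial_at_even_leads\<close>).
\<close>

section \<open>Products of integer powers\<close>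

lemma prod_powi_exponents:
  fixes x :: "'k::field"
  assumes "x \<noteq> 0"
  shows "(\<Prod>a\<in>A. x powi e a) = x powi (\<Sum>a\<in>A. e a)"
  using assms by (induction A rule: infinite_finite_induct) (auto simp: power_int_add)

lemma prod_powi_bases:
  fixes F :: "'a \<Rightarrow> 'k::field"
  shows "(\<Prod>a\<in>A. F a) powi e = (\<Prod>a\<in>A. F a powi e)"
  by (induction A rule: infinite_finite_induct) (auto simp: power_int_mult_distrib)

text \<open>The terms cancel in pairs under \<open>(i, j) \<mapsto> (j, i)\<close>. This is the form in which the square of the
  coboundary vanishes.\<close>
lemma prod_off_diagonal_eq_1:
  fixes P :: "'a \<Rightarrow> 'a \<Rightarrow> 'b::comm_monoid_mult"
  assumes "finite I" and "\<And>i j. i \<in> I \<Longrightarrow> j \<in> I \<Longrightarrow> i \<noteq> j \<Longrightarrow> P i j * P j i = 1"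
  shows "(\<Prod>i\<in>I. \<Prod>j\<in>I - {i}. P i j) = 1"
  using assms
proof (induction I)
  case (insert x I)
  have "(\<Prod>j\<in>insert x I - {i}. P i j) = P i x * (\<Prod>j\<in>I - {i}. P i j)" if "i \<in> I" for i
  proof -
    have "insert x I - {i} = insert x (I - {i})" using that insert.hyps by auto
    then show ?thesis using insert.hyps by simp
  qed
  moreover have "insert x I - {x} = I" using insert.hyps by auto
  ultimately have "(\<Prod>i\<in>insert x I. \<Prod>j\<in>insert x I - {i}. P i j)
      = (\<Prod>j\<in>I. P x j) * ((\<Prod>i\<in>I. P i x) * (\<Prod>i\<in>I. \<Prod>j\<in>I - {i}. P i j))"
    using insert.hyps by (simp add: prod.distrib)
  also have "\<dots> = (\<Prod>j\<in>I. P x j * P j x)"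
    using insert.IH insert.prems by (simp add: prod.distrib)
  also have "\<dots> = 1"
    using insert.hyps insert.prems by (intro prod.neutral) auto
  finally show ?case .
qed simp

section \<open>The coboundary on families of values\<close>

definition decrement :: "(nat \<Rightarrow> nat) \<Rightarrow> nat \<Rightarrow> (nat \<Rightarrow> nat)" where
  "decrement b i = b(i := b i - 1)"

definition koszul_sign :: "(nat \<Rightarrow> nat) \<Rightarrow> nat \<Rightarrow> int" where
  "koszul_sign b i = (-1) ^ (\<Sum>l=1..<i. b l)"

text \<open>The positions at which the differential of the generator for \<open>b\<close> has a norm element as its
  coefficient. The other nonzero entries are odd; their coefficients \<open>g\<^sub>i - 1\<close> act trivially.\<close>
definition norm_positions :: "nat \<Rightarrow> (nat \<Rightarrow> nat) \<Rightarrow> nat set" where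
  "norm_positions n b = {i \<in> {1..n}. b i \<noteq> 0 \<and> even (b i)}"

text \<open>The values of the codifferential of a cochain with values \<open>F\<close>. A family is indexed by the
  sequences of all degrees at once, which keeps the degree out of the arguments below.\<close>
definition coboundary_values ::
  "nat \<Rightarrow> (nat \<Rightarrow> nat) \<Rightarrow> ((nat \<Rightarrow> nat) \<Rightarrow> 'k::field) \<Rightarrow> ((nat \<Rightarrow> nat) \<Rightarrow> 'k)" where
  "coboundary_values n m F b =
     (\<Prod>i\<in>norm_positions n b. F (decrement b i) powi (koszul_sign b i * int (m i)))"

lemma finite_norm_positions [simp]: "finite (norm_positions n b)"
  by (simp add: norm_positions_def)

lemma norm_positions_decrement:
  assumes "i \<in> norm_positions n b"
  shows "norm_positions n (decrement b i) = norm_positions n b - {i}"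
  using assms by (auto simp: norm_positions_def decrement_def)

text \<open>Lowering an entry flips exactly the signs at the later positions. Hence of the two orders in
  which two entries can be lowered, exactly one picks up an additional sign.\<close>
lemma koszul_sign_decrement:
  assumes "1 \<le> i" and "b i \<noteq> 0"
  shows "koszul_sign (decrement b i) j = (if i < j then - koszul_sign b j else koszul_sign b j)"
proof (cases "i < j")
  case True
  have "(\<Sum>l=1..<j. b l) = b i + (\<Sum>l\<in>{1..<j} - {i}. b l)"
    using True assms by (intro sum.remove) auto
  moreover have "(\<Sum>l=1..<j. decrement b i l) = decrement b i i + (\<Sum>l\<in>{1..<j} - {i}. decrement b i l)"
    using True assms by (intro sum.remove) auto
  moreover have "(\<Sum>l\<in>{1..<j} - {i}. decrement b i l) = (\<Sum>l\<in>{1..<j} - {i}. b l)"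
    by (intro sum.cong) (auto simp: decrement_def)
  ultimately have "(\<Sum>l=1..<j. b l) = Suc (\<Sum>l=1..<j. decrement b i l)"
    using assms by (simp add: decrement_def)
  then show ?thesis using True by (simp add: koszul_sign_def)
next
  case False
  then have "(\<Sum>l=1..<j. decrement b i l) = (\<Sum>l=1..<j. b l)"
    by (intro sum.cong) (auto simp: decrement_def)
  then show ?thesis using False by (simp add: koszul_sign_def)
qed

lemma coboundary_values_nonzero:
  assumes "\<And>a. F a \<noteq> 0"
  shows "coboundary_values n m F b \<noteq> 0"
  using assms by (simp add: coboundary_values_def power_int_eq_0_iff)

lemma coboundary_values_divide:
  "coboundary_values n m (\<lambda>a. F a / H a) b = coboundary_values n m F b / coboundary_values n m H b"
  by (simp add: coboundary_values_def power_int_divide_distrib prod_dividef)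

text \<open>Lowering entries \<open>i\<close> and \<open>j\<close> in either order contributes the same value with opposite exponents
  \<open>\<plusminus> m\<^sub>i m\<^sub>j\<close>. The pairs \<open>i = j\<close> do not occur: an even entry becomes odd when it is lowered.\<close>
lemma coboundary_values_coboundary_values:
  fixes F :: "(nat \<Rightarrow> nat) \<Rightarrow> 'k::field"
  assumes "\<And>a. F a \<noteq> 0"
  shows "coboundary_values n m (coboundary_values n m F) b = 1"
proof -
  define I where "I = norm_positions n b"
  define e where "e i j = koszul_sign (decrement b i) j * int (m j) * (koszul_sign b i * int (m i))" for i j
  define P where "P i j = F (decrement (decrement b i) j) powi e i j" for i j
  have "coboundary_values n m F (decrement b i) powi (koszul_sign b i * int (m i)) = (\<Prod>j\<in>I - {i}. P i j)"
    if "i \<in> I" for i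
    using that norm_positions_decrement[of i n b]
    by (simp add: coboundary_values_def prod_powi_bases P_def e_def I_def flip: power_int_mult)
  then have "coboundary_values n m (coboundary_values n m F) b = (\<Prod>i\<in>I. \<Prod>j\<in>I - {i}. P i j)"
    by (simp add: coboundary_values_def[of n m "coboundary_values n m F"] I_def)
  also have "\<dots> = 1"
  proof (rule prod_off_diagonal_eq_1)
    show "P i j * P j i = 1" if "i \<in> I" "j \<in> I" "i \<noteq> j" for i j
    proof -
      have "decrement (decrement b i) j = decrement (decrement b j) i"
        using that by (auto simp: decrement_def)
      moreover have "e i j + e j i = 0"
        using that by (auto simp: e_def I_def norm_positions_def koszul_sign_decrement)
      ultimately show ?thesis
        using assms power_int_add[of "F (decrement (decrement b i) j)" "e i j" "e j i"] by (simp add: P_def)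
    qed
  qed (simp add: I_def)
  finally show ?thesis .
qed

section \<open>Leading positions and normalization\<close>

definition leads :: "nat \<Rightarrow> (nat \<Rightarrow> nat) \<Rightarrow> nat \<Rightarrow> bool" where
  "leads n a p \<longleftrightarrow> p \<in> {1..n} \<and> a p \<noteq> 0 \<and> (\<forall>j\<in>{1..<p}. a j = 0)"

lemma leads_unique: "leads n a p \<Longrightarrow> leads n a q \<Longrightarrow> p = q"
  unfolding leads_def by (metis atLeastAtMost_iff atLeastLessThan_iff linorder_neqE_nat)

lemma leads_exists:
  assumes "i \<in> {1..n}" and "a i \<noteq> 0"
  obtains p where "leads n a p" "p \<le> i"
proof -
  let ?p = "LEAST p. p \<in> {1..n} \<and> a p \<noteq> 0"
  have "?p \<in> {1..n} \<and> a ?p \<noteq> 0" "?p \<le> i"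
    using assms LeastI[of "\<lambda>p. p \<in> {1..n} \<and> a p \<noteq> 0" i]
      Least_le[of "\<lambda>p. p \<in> {1..n} \<and> a p \<noteq> 0" i] by blast+
  moreover have "a j = 0" if "j \<in> {1..<?p}" for j
    using not_less_Least[of j "\<lambda>p. p \<in> {1..n} \<and> a p \<noteq> 0"] that calculation by auto
  ultimately show ?thesis using that unfolding leads_def by blast
qed

lemma koszul_sign_leads: "leads n a p \<Longrightarrow> koszul_sign a p = 1"
  by (simp add: koszul_sign_def leads_def)

lemma leads_upd: "leads n a p \<Longrightarrow> v \<noteq> 0 \<Longrightarrow> leads n (a(p := v)) p"
  by (auto simp: leads_def)

lemma leads_decrement:
  assumes "leads n b p" and "i \<in> norm_positions n b"
  shows "leads n (decrement b i) p" and "p \<le> i"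
  using assms by (auto simp: leads_def norm_positions_def decrement_def
      dest: evenE[of "b i"] intro: ccontr)

text \<open>Lowering an entry other than the leading one leaves the leading entry even, so only the factor
  at the leading position survives. Its sign is positive, since all earlier entries vanish.\<close>
lemma coboundary_values_even_lead:
  assumes triv: "\<And>a p. leads n a p \<Longrightarrow> even (a p) \<Longrightarrow> F a = 1"
    and lead: "leads n b p" and ev: "even (b p)"
  shows "coboundary_values n m F b = F (decrement b p) ^ m p"
proof -
  have p: "p \<in> norm_positions n b"
    using lead ev by (simp add: norm_positions_def leads_def)
  have "F (decrement b i) = 1" if "i \<in> norm_positions n b - {p}" for i
    using that ev by (intro triv[OF leads_decrement(1)[OF lead]]) (auto simp: decrement_def)
  then show ?thesis
    unfolding coboundary_values_def prod.remove[OF finite_norm_positions p]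
    by (simp add: koszul_sign_leads[OF lead])
qed

text \<open>Take \<open>L\<close> trivial at even leading entries. Then each prescribed value determines the value of \<open>L\<close> at a
  single sequence up to a root of unity, by \<open>coboundary_values_even_lead\<close>, and distinct
  prescriptions concern distinct sequences.\<close>
lemma coboundary_prescribed_at_even_leads:
  fixes F :: "(nat \<Rightarrow> nat) \<Rightarrow> 'k::alg_closed_field"
  assumes m: "\<And>i. i \<in> {1..n} \<Longrightarrow> m i \<ge> 1" and F: "\<And>a. F a \<noteq> 0"
  obtains L where "\<And>a. L a \<noteq> 0"
    and "\<And>a p. leads n a p \<Longrightarrow> even (a p) \<Longrightarrow> coboundary_values n m L a = F a"
proof -
  \<comment> \<open>Raising the odd leading entry of \<open>c\<close> gives the sequence whose prescribed value decides \<open>L c\<close>.\<close>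
  have "\<exists>y. (\<forall>p. leads n c p \<longrightarrow> (if even (c p) then y = 1 else y ^ m p = F (c(p := c p + 1)))) \<and> y \<noteq> 0"
    for c
  proof (cases "\<exists>p. leads n c p \<and> odd (c p)")
    case True
    then obtain p where p: "leads n c p" "odd (c p)" by blast
    then have "m p > 0" using m[of p] by (simp add: leads_def)
    then obtain y where y: "y ^ m p = F (c(p := c p + 1))"
      using nth_root_exists by blast
    with F \<open>m p > 0\<close> have "y \<noteq> 0" by (metis power_0_left not_gr_zero)
    with y p leads_unique show ?thesis by metis
  next
    case False
    then show ?thesis by (intro exI[of _ 1]) auto
  qed
  then obtain L where L: "\<And>c p. leads n c p \<Longrightarrow>
      if even (c p) then L c = 1 else L c ^ m p = F (c(p := c p + 1))" "\<And>c. L c \<noteq> 0"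
    by metis
  show ?thesis
  proof
    fix a p assume a: "leads n a p" "even (a p)"
    then have "coboundary_values n m L a = L (decrement a p) ^ m p"
      using L(1) by (intro coboundary_values_even_lead) (auto split: if_splits)
    moreover have "leads n (decrement a p) p" "odd (decrement a p p)"
      using a by (auto simp: leads_def decrement_def)
    ultimately show "coboundary_values n m L a = F a"
      using L(1)[of "decrement a p" p] a by (auto simp: decrement_def leads_def)
  qed (rule L(2))
qed

text \<open>Raising an odd leading entry of \<open>a\<close> gives a sequence at which the coboundary is \<open>(F a) ^ m\<^sub>p\<close>.\<close>
lemma torsion_of_even_lead_coboundary:
  assumes triv: "\<And>a p. leads n a p \<Longrightarrow> even (a p) \<Longrightarrow> F a = 1"
    and cob: "\<And>b p. leads n b p \<Longrightarrow> even (b p) \<Longrightarrow> coboundary_values n m F b = 1"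
    and lead: "leads n a p"
  shows "F a ^ m p = 1"
proof (cases "even (a p)")
  case True
  then show ?thesis using triv lead by simp
next
  case False
  let ?b = "a(p := a p + 1)"
  have b: "leads n ?b p" "even (?b p)" and "decrement ?b p = a"
    using lead False leads_upd by (auto simp: decrement_def)
  moreover have "coboundary_values n m F ?b = F (decrement ?b p) ^ m p"
    using triv by (rule coboundary_values_even_lead) (use b in auto)
  ultimately show ?thesis using cob[OF b] by metis
qed

text \<open>Lowering the entry at a position \<open>i\<close> with \<open>b\<^sub>i\<close> even keeps the leading position \<open>p\<close>: if \<open>i = p\<close>,
  the entry is even, hence at least \<open>2\<close>. So the power \<open>m\<^sub>p\<close> of the value there is \<open>1\<close>, and therefore
  so is the power \<open>m\<^sub>i\<close>.\<close>
lemma coboundary_values_torsion: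
  assumes mono: "\<And>i j. 1 \<le> i \<Longrightarrow> i \<le> j \<Longrightarrow> j \<le> n \<Longrightarrow> m i dvd m j"
    and tors: "\<And>a p. leads n a p \<Longrightarrow> F a ^ m p = 1"
  shows "coboundary_values n m F b = 1"
  unfolding coboundary_values_def
proof (rule prod.neutral, rule ballI)
  fix i assume i: "i \<in> norm_positions n b"
  then obtain p where p: "leads n b p"
    using leads_exists[of i n b] by (auto simp: norm_positions_def)
  then have "m p dvd m i"
    using leads_decrement(2)[OF p i] i mono by (auto simp: leads_def norm_positions_def)
  then have "F (decrement b i) ^ m i = 1"
    using tors[OF leads_decrement(1)[OF p i]] by (auto simp: power_mult elim!: dvdE)
  then have "F (decrement b i) powi (int (m i) * koszul_sign b i) = 1"
    by (simp only: power_int_mult) simp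
  then show "F (decrement b i) powi (koszul_sign b i * int (m i)) = 1"
    by (simp add: mult.commute)
qed

text \<open>Dividing \<open>H\<close> by a suitable coboundary makes it trivial at even leading entries without changing its
  coboundary. The triviality of the coboundary at even leading entries then says that the
  quotient is torsion, which makes it a cocycle.\<close>
lemma coboundary_trivial_if_trivial_at_even_leads:
  fixes H :: "(nat \<Rightarrow> nat) \<Rightarrow> 'k::alg_closed_field"
  assumes m: "\<And>i. i \<in> {1..n} \<Longrightarrow> m i \<ge> 1"
    and mono: "\<And>i j. 1 \<le> i \<Longrightarrow> i \<le> j \<Longrightarrow> j \<le> n \<Longrightarrow> m i dvd m j"
    and H: "\<And>a. H a \<noteq> 0"
    and triv: "\<And>b p. leads n b p \<Longrightarrow> even (b p) \<Longrightarrow> coboundary_values n m H b = 1"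
  shows "coboundary_values n m H b = 1"
proof -
  obtain L where L: "\<And>a. L a \<noteq> 0"
    "\<And>a p. leads n a p \<Longrightarrow> even (a p) \<Longrightarrow> coboundary_values n m L a = H a"
    using coboundary_prescribed_at_even_leads[of n m H] m H by metis
  define H' where "H' = (\<lambda>a. H a / coboundary_values n m L a)"
  have same: "coboundary_values n m H' c = coboundary_values n m H c" for c
    by (simp add: H'_def coboundary_values_divide coboundary_values_coboundary_values L)
  have "H' a = 1" if "leads n a p" "even (a p)" for a p
    using L(2)[OF that] H by (simp add: H'_def)
  then have "H' a ^ m p = 1" if "leads n a p" for a p
    using torsion_of_even_lead_coboundary[of n H' m a p] triv that same by auto
  with coboundary_values_torsion[of n m H'] mono same show ?thesis by simp
qed

section \<open>Powers of a primitive root of unity\<close>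

text \<open>The powers \<open>z ^ e\<close> with \<open>e < q\<close> are \<open>q\<close> distinct roots of \<open>X\<^sup>q - 1\<close>, hence all of them.\<close>
lemma power_eq_1_iff_power_of_primitive_root:
  fixes z :: "'k::field"
  assumes "primitive_root_of_unity q z"
  shows "x ^ q = 1 \<longleftrightarrow> (\<exists>e<q. x = z ^ e)"
proof
  assume x: "x ^ q = 1"
  have q: "q > 0" and z: "z ^ q = 1" "z \<noteq> 0"
    using assms by (auto simp: primitive_root_of_unity_def power_0_left)
  define p :: "'k poly" where "p = monom 1 q - 1"
  have p_roots: "poly p y = 0 \<longleftrightarrow> y ^ q = 1" for y
    by (simp add: p_def poly_monom)
  have deg: "degree p \<le> q"
    by (auto simp: p_def intro!: degree_diff_le degree_monom_le)
  have p0: "p \<noteq> 0"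
    using q p_roots[of 0] by (auto simp: power_0_left)
  have "inj_on (\<lambda>e. z ^ e) {..<q}"
  proof (rule linorder_inj_onI)
    fix d e assume de: "d < e" "d \<in> {..<q}" "e \<in> {..<q}"
    have "z ^ e = z ^ d * z ^ (e - d)"
      using de by (simp flip: power_add)
    moreover have "z ^ (e - d) \<noteq> 1"
      using assms de by (simp add: primitive_root_of_unity_def)
    ultimately show "z ^ d \<noteq> z ^ e" using z by auto
  qed auto
  then have "card ((\<lambda>e. z ^ e) ` {..<q}) = q" by (simp add: card_image)
  moreover have sub: "(\<lambda>e. z ^ e) ` {..<q} \<subseteq> {y. poly p y = 0}"
    using z by (auto simp: p_roots simp flip: power_mult) (metis mult.commute power_mult power_one)
  moreover have "card {y. poly p y = 0} \<le> q"
    using card_poly_roots_bound[OF p0] deg by simp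
  ultimately have "(\<lambda>e. z ^ e) ` {..<q} = {y. poly p y = 0}"
    using poly_roots_finite[OF p0] by (metis card_seteq)
  then show "\<exists>e<q. x = z ^ e" using x p_roots by auto
next
  assume "\<exists>e<q. x = z ^ e"
  then show "x ^ q = 1"
    using assms by (metis mult.commute power_mult power_one primitive_root_of_unity_def)
qed



section \<open>The integral group ring and its augmentation\<close>

definition augmentation :: "('g \<Rightarrow> int) \<Rightarrow> int" where
  "augmentation r = (\<Sum>g | r g \<noteq> 0. r g)"

lemma augmentation_eq_sum:
  assumes "finite S" and "{g. r g \<noteq> 0} \<subseteq> S"
  shows "augmentation r = sum r S"
  unfolding augmentation_def using assms by (intro sum.mono_neutral_left) auto

lemma units_module_simps [simp]:
  "carrier units_module = {x. x \<noteq> 0}"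
  "x \<oplus>\<^bsub>units_module\<^esub> y = x * y"
  by (simp_all add: units_module_def)

text \<open>As \<open>G\<close> acts trivially, only the augmentation of a group ring element is visible in the
  coefficients.\<close>
lemma units_module_smult [simp]:
  fixes x :: "'k::field"
  shows "x \<noteq> 0 \<Longrightarrow> r \<odot>\<^bsub>units_module\<^esub> x = x powi augmentation r"
  by (simp add: units_module_def prod_powi_exponents augmentation_def)

context monoid
begin

abbreviation ZG where "ZG \<equiv> group_ring G"

lemma group_ring_simps [simp]:
  "carrier ZG = {r. finite {x. r x \<noteq> 0} \<and> {x. r x \<noteq> 0} \<subseteq> carrier G}"
  "\<zero>\<^bsub>ZG\<^esub> = (\<lambda>x. 0)"
  "\<one>\<^bsub>ZG\<^esub> = group_ring_of \<one>"
  "r \<oplus>\<^bsub>ZG\<^esub> s = (\<lambda>x. r x + s x)"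
  by (simp_all add: group_ring_def group_ring_of_def)

lemma group_ring_mult:
  "r \<otimes>\<^bsub>ZG\<^esub> s = (\<lambda>x. \<Sum>y | r y \<noteq> 0. \<Sum>z | s z \<noteq> 0 \<and> y \<otimes> z = x. r y * s z)"
  by (simp add: group_ring_def)

lemma group_ring_add_closed:
  assumes "r \<in> carrier ZG" and "s \<in> carrier ZG"
  shows "r \<oplus>\<^bsub>ZG\<^esub> s \<in> carrier ZG"
proof -
  have sub: "{x. r x + s x \<noteq> 0} \<subseteq> {x. r x \<noteq> 0} \<union> {x. s x \<noteq> 0}"
    by auto
  moreover have "finite ({x. r x \<noteq> 0} \<union> {x. s x \<noteq> 0})" "{x. r x \<noteq> 0} \<union> {x. s x \<noteq> 0} \<subseteq> carrier G"
    using assms by auto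
  ultimately have "finite {x. r x + s x \<noteq> 0} \<and> {x. r x + s x \<noteq> 0} \<subseteq> carrier G"
    using finite_subset subset_trans by blast
  then show ?thesis by simp
qed

lemma abelian_group_group_ring: "abelian_group ZG"
proof (rule abelian_groupI)
  fix r assume "r \<in> carrier ZG"
  then show "\<exists>s\<in>carrier ZG. s \<oplus>\<^bsub>ZG\<^esub> r = \<zero>\<^bsub>ZG\<^esub>"
    by (intro bexI[of _ "\<lambda>x. - r x"]) auto
qed (simp_all only: group_ring_add_closed, simp_all add: add.commute add.left_commute)

interpretation ZG: abelian_group ZG
  by (rule abelian_group_group_ring)

lemma group_ring_of_closed [simp]: "g \<in> carrier G \<Longrightarrow> group_ring_of g \<in> carrier ZG"
  by (auto simp: group_ring_of_def)

lemma augmentation_group_ring_of [simp]: "augmentation (group_ring_of g) = 1"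
  by (simp add: augmentation_def group_ring_of_def)

lemma augmentation_add:
  assumes "r \<in> carrier ZG" and "s \<in> carrier ZG"
  shows "augmentation (r \<oplus>\<^bsub>ZG\<^esub> s) = augmentation r + augmentation s"
proof -
  let ?S = "{x. r x \<noteq> 0} \<union> {x. s x \<noteq> 0}"
  have "finite ?S" using assms by simp
  moreover have "{x. r x + s x \<noteq> 0} \<subseteq> ?S" by auto
  ultimately show ?thesis
    using augmentation_eq_sum[of ?S r] augmentation_eq_sum[of ?S s]
      augmentation_eq_sum[of ?S "\<lambda>x. r x + s x"] by (simp add: sum.distrib)
qed

lemma augmentation_zero [simp]: "augmentation (\<lambda>x. 0) = 0"
  by (simp add: augmentation_def)

lemma augmentation_uminus:
  assumes "r \<in> carrier ZG"
  shows "augmentation (\<ominus>\<^bsub>ZG\<^esub> r) = - augmentation r"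
  using augmentation_add[of r "\<ominus>\<^bsub>ZG\<^esub> r"] ZG.r_neg[of r] ZG.a_inv_closed[of r] assms
    by (simp del: group_ring_simps(1,4))

lemma augmentation_finsum:
  assumes "finite A" and "\<And>x. x \<in> A \<Longrightarrow> t x \<in> carrier ZG"
  shows "augmentation (\<Oplus>\<^bsub>ZG\<^esub>x\<in>A. t x) = (\<Sum>x\<in>A. augmentation (t x))"
  using assms
proof (induction A)
  case (insert x A)
  have "(\<Oplus>\<^bsub>ZG\<^esub>x\<in>insert x A. t x) = t x \<oplus>\<^bsub>ZG\<^esub> (\<Oplus>\<^bsub>ZG\<^esub>x\<in>A. t x)"
    using insert by (intro ZG.finsum_insert) blast+
  moreover have "(\<Oplus>\<^bsub>ZG\<^esub>x\<in>A. t x) \<in> carrier ZG" and "t x \<in> carrier ZG"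
    using insert.prems by (blast intro: ZG.finsum_closed)+
  ultimately show ?case
    using insert augmentation_add by simp
qed simp

lemma group_ring_mult_support:
  "{x. (r \<otimes>\<^bsub>ZG\<^esub> s) x \<noteq> 0} \<subseteq> (\<lambda>(y, z). y \<otimes> z) ` ({y. r y \<noteq> 0} \<times> {z. s z \<noteq> 0})"
proof
  fix x assume "x \<in> {x. (r \<otimes>\<^bsub>ZG\<^esub> s) x \<noteq> 0}"
  then have "(\<Sum>y | r y \<noteq> 0. \<Sum>z | s z \<noteq> 0 \<and> y \<otimes> z = x. r y * s z) \<noteq> 0"
    by (simp add: group_ring_mult)
  then obtain y where y: "r y \<noteq> 0" "(\<Sum>z | s z \<noteq> 0 \<and> y \<otimes> z = x. r y * s z) \<noteq> 0"
    by (rule sum.not_neutral_contains_not_neutral) blast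
  from y(2) obtain z where "s z \<noteq> 0" "y \<otimes> z = x"
    by (rule sum.not_neutral_contains_not_neutral) blast
  with y(1) show "x \<in> (\<lambda>(y, z). y \<otimes> z) ` ({y. r y \<noteq> 0} \<times> {z. s z \<noteq> 0})" by force
qed

lemma group_ring_mult_closed:
  assumes "r \<in> carrier ZG" and "s \<in> carrier ZG"
  shows "r \<otimes>\<^bsub>ZG\<^esub> s \<in> carrier ZG"
proof -
  have "finite ((\<lambda>(y, z). y \<otimes> z) ` ({y. r y \<noteq> 0} \<times> {z. s z \<noteq> 0}))"
    using assms by simp
  moreover have "(\<lambda>(y, z). y \<otimes> z) ` ({y. r y \<noteq> 0} \<times> {z. s z \<noteq> 0}) \<subseteq> carrier G"
    using assms by auto
  ultimately show ?thesis
    using finite_subset[OF group_ring_mult_support[of r s]] group_ring_mult_support[of r s]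
    unfolding group_ring_simps(1) by blast
qed

text \<open>Each pair \<open>(y, z)\<close> of support elements contributes to exactly one coefficient of the product, so
  summing over all coefficients collects every term \<open>r y * s z\<close> once.\<close>
lemma augmentation_mult:
  assumes "r \<in> carrier ZG" and "s \<in> carrier ZG"
  shows "augmentation (r \<otimes>\<^bsub>ZG\<^esub> s) = augmentation r * augmentation s"
proof -
  let ?Y = "{y. r y \<noteq> 0}" and ?Z = "{z. s z \<noteq> 0}"
  let ?S = "(\<lambda>(y, z). y \<otimes> z) ` (?Y \<times> ?Z)"
  have fin: "finite ?Y" "finite ?Z" "finite ?S" using assms by simp_all
  have "augmentation (r \<otimes>\<^bsub>ZG\<^esub> s) = (\<Sum>x\<in>?S. (r \<otimes>\<^bsub>ZG\<^esub> s) x)"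
    by (rule augmentation_eq_sum[OF fin(3) group_ring_mult_support])
  also have "\<dots> = (\<Sum>x\<in>?S. \<Sum>y\<in>?Y. \<Sum>z | s z \<noteq> 0 \<and> y \<otimes> z = x. r y * s z)"
    by (simp add: group_ring_mult)
  also have "\<dots> = (\<Sum>y\<in>?Y. \<Sum>x\<in>?S. \<Sum>z | s z \<noteq> 0 \<and> y \<otimes> z = x. r y * s z)"
    by (rule sum.swap)
  also have "\<dots> = (\<Sum>y\<in>?Y. \<Sum>z\<in>?Z. r y * s z)"
  proof (rule sum.cong)
    fix y assume "y \<in> ?Y"
    then show "(\<Sum>x\<in>?S. \<Sum>z | s z \<noteq> 0 \<and> y \<otimes> z = x. r y * s z) = (\<Sum>z\<in>?Z. r y * s z)"
      using sum.group[OF fin(2,3), of "\<lambda>z. y \<otimes> z" "\<lambda>z. r y * s z"] by force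
  qed simp
  also have "\<dots> = augmentation r * augmentation s"
    by (simp add: augmentation_def sum_product)
  finally show ?thesis .
qed

lemma group_ring_mult_one:
  assumes "r \<in> carrier ZG"
  shows "r \<otimes>\<^bsub>ZG\<^esub> \<one>\<^bsub>ZG\<^esub> = r"
proof
  fix x
  have "(\<Sum>z | group_ring_of \<one> z \<noteq> 0 \<and> y \<otimes> z = x. r y * group_ring_of \<one> z)
      = (if y = x then r y else 0)" if "r y \<noteq> 0" for y
  proof -
    have "y \<otimes> \<one> = y" using that assms by auto
    then have "{z. group_ring_of \<one> z \<noteq> 0 \<and> y \<otimes> z = x} = (if y = x then {\<one>} else {})"
      by (auto simp: group_ring_of_def)
    then show ?thesis by (simp add: group_ring_of_def)
  qed
  then have "(r \<otimes>\<^bsub>ZG\<^esub> \<one>\<^bsub>ZG\<^esub>) x = (\<Sum>y | r y \<noteq> 0. if y = x then r y else 0)"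
    by (simp add: group_ring_mult)
  also have "\<dots> = r x"
    using assms by (simp add: sum.delta)
  finally show "(r \<otimes>\<^bsub>ZG\<^esub> \<one>\<^bsub>ZG\<^esub>) x = r x" .
qed

lemma group_ring_mult_zero: "r \<otimes>\<^bsub>ZG\<^esub> \<zero>\<^bsub>ZG\<^esub> = \<zero>\<^bsub>ZG\<^esub>"
  by (simp add: group_ring_mult)

lemma
  assumes "r \<in> carrier ZG"
  shows group_ring_pow_closed: "r [^]\<^bsub>ZG\<^esub> (j::nat) \<in> carrier ZG"
    and augmentation_pow: "augmentation (r [^]\<^bsub>ZG\<^esub> j) = augmentation r ^ j"
proof -
  have "r [^]\<^bsub>ZG\<^esub> j \<in> carrier ZG \<and> augmentation (r [^]\<^bsub>ZG\<^esub> j) = augmentation r ^ j"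
  proof (induction j)
    case 0
    then show ?case using group_ring_of_closed[of \<one>] by (simp add: nat_pow_def del: group_ring_simps(1))
  next
    case (Suc j)
    then show ?case
      using assms group_ring_mult_closed augmentation_mult
      by (simp add: nat_pow_def del: group_ring_simps(1))
  qed
  then show "r [^]\<^bsub>ZG\<^esub> j \<in> carrier ZG" "augmentation (r [^]\<^bsub>ZG\<^esub> j) = augmentation r ^ j"
    by blast+
qed

declare group_ring_simps(1) [simp del]

lemma
  assumes "g \<in> carrier G"
  shows T_elt_closed: "T_elt G g \<in> carrier ZG"
    and augmentation_T_elt: "augmentation (T_elt G g) = 0"
proof -
  have closed: "group_ring_of g \<in> carrier ZG" "\<ominus>\<^bsub>ZG\<^esub> group_ring_of \<one> \<in> carrier ZG"
    using assms by (simp_all add: ZG.a_inv_closed)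
  show "T_elt G g \<in> carrier ZG"
    unfolding T_elt_def ZG.minus_eq group_ring_simps(3) by (rule ZG.a_closed[OF closed])
  show "augmentation (T_elt G g) = 0"
    unfolding T_elt_def ZG.minus_eq group_ring_simps(3) augmentation_add[OF closed]
    by (simp add: augmentation_uminus)
qed

lemma
  assumes "g \<in> carrier G"
  shows N_elt_closed: "N_elt G q g \<in> carrier ZG"
    and augmentation_N_elt: "augmentation (N_elt G q g) = int q"
proof -
  have closed: "group_ring_of (g [^] (j::nat)) \<in> carrier ZG" for j
    using assms by simp
  then show "N_elt G q g \<in> carrier ZG"
    unfolding N_elt_def by (blast intro: ZG.finsum_closed)
  show "augmentation (N_elt G q g) = int q"
    unfolding N_elt_def by (simp add: augmentation_finsum closed)
qed

section \<open>Cochains and their values on the generators\<close>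

abbreviation K where "K n k \<equiv> koszul_module G n k"

lemma koszul_module_simps [simp]:
  "carrier (K n k) = {c. (\<forall>a. c a \<in> carrier ZG) \<and> (\<forall>a. a \<notin> exponents n k \<longrightarrow> c a = \<zero>\<^bsub>ZG\<^esub>)}"
  "\<zero>\<^bsub>K n k\<^esub> = (\<lambda>a. \<zero>\<^bsub>ZG\<^esub>)"
  "c \<oplus>\<^bsub>K n k\<^esub> d = (\<lambda>a. c a \<oplus>\<^bsub>ZG\<^esub> d a)"
  "r \<odot>\<^bsub>K n k\<^esub> c = (\<lambda>a. r \<otimes>\<^bsub>ZG\<^esub> c a)"
  by (simp_all add: koszul_module_def)

lemma abelian_monoid_koszul_module: "abelian_monoid (K n k)"
proof (rule abelian_monoidI)
qed (use ZG.a_closed ZG.zero_closed in \<open>auto simp: fun_eq_iff add.commute add.assoc\<close>)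

lemma finite_exponents: "finite (exponents n k)"
proof (rule finite_subset)
  show "exponents n k \<subseteq> {a. \<forall>j. (j \<in> {1..n} \<longrightarrow> a j \<in> {..k}) \<and> (j \<notin> {1..n} \<longrightarrow> a j = 0)}"
    by (auto simp: exponents_def intro: member_le_sum)
  show "finite {a. \<forall>j. (j \<in> {1..n} \<longrightarrow> a j \<in> {..k}) \<and> (j \<notin> {1..n} \<longrightarrow> a j = 0)}"
    by (intro finite_set_of_finite_funs) auto
qed

lemma smult_closed:
  "r \<in> carrier ZG \<Longrightarrow> c \<in> carrier (K n k) \<Longrightarrow> r \<odot>\<^bsub>K n k\<^esub> c \<in> carrier (K n k)"
  by (auto simp: group_ring_mult_closed group_ring_mult_zero simp del: group_ring_simps(2))

lemma Phi_closed: "a \<in> exponents n k \<Longrightarrow> Phi G a \<in> carrier (K n k)"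
  using ZG.zero_closed by (auto simp: Phi_def)


lemma augmentation_Phi: "augmentation (Phi G a b) = (if b = a then 1 else 0)"
  by (simp add: Phi_def)

interpretation K: abelian_monoid "K n k" for n k
  by (rule abelian_monoid_koszul_module)

text \<open>Freeness on the generators, in the form used to recover a cochain from its values on them.\<close>
lemma koszul_module_expansion:
  assumes "c \<in> carrier (K n k)"
  shows "c = (\<Oplus>\<^bsub>K n k\<^esub>a\<in>exponents n k. c a \<odot>\<^bsub>K n k\<^esub> Phi G a)"
proof -
  have term_closed: "c a \<odot>\<^bsub>K n k\<^esub> Phi G a \<in> carrier (K n k)" if "a \<in> exponents n k" for a
    using assms that by (intro smult_closed Phi_closed) simp_all
  have c_closed: "c a \<in> carrier ZG" for a using assms by simp
  have "(\<Oplus>\<^bsub>K n k\<^esub>a\<in>A. c a \<odot>\<^bsub>K n k\<^esub> Phi G a) = (\<lambda>b. if b \<in> A then c b else \<zero>\<^bsub>ZG\<^esub>)"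
    if "A \<subseteq> exponents n k" for A
    using finite_subset[OF that finite_exponents] that
  proof (induction A)
    case empty
    show ?case by (simp only: K.finsum_empty koszul_module_simps(2)) simp
  next
    case (insert a A)
    have "(\<Oplus>\<^bsub>K n k\<^esub>a\<in>insert a A. c a \<odot>\<^bsub>K n k\<^esub> Phi G a)
        = c a \<odot>\<^bsub>K n k\<^esub> Phi G a \<oplus>\<^bsub>K n k\<^esub> (\<Oplus>\<^bsub>K n k\<^esub>a\<in>A. c a \<odot>\<^bsub>K n k\<^esub> Phi G a)"
      using insert.hyps insert.prems term_closed by (intro K.finsum_insert) blast+
    also have "\<dots> = c a \<odot>\<^bsub>K n k\<^esub> Phi G a \<oplus>\<^bsub>K n k\<^esub> (\<lambda>b. if b \<in> A then c b else \<zero>\<^bsub>ZG\<^esub>)"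
      using insert.IH insert.prems by simp
    also have "\<dots> = (\<lambda>b. if b \<in> insert a A then c b else \<zero>\<^bsub>ZG\<^esub>)"
    proof
      fix b
      show "(c a \<odot>\<^bsub>K n k\<^esub> Phi G a \<oplus>\<^bsub>K n k\<^esub> (\<lambda>b. if b \<in> A then c b else \<zero>\<^bsub>ZG\<^esub>)) b
          = (if b \<in> insert a A then c b else \<zero>\<^bsub>ZG\<^esub>)"
        using insert.hyps group_ring_mult_one[OF c_closed, of a] group_ring_mult_zero[of "c a"]
        by (cases "b = a") (simp_all add: Phi_def)
    qed
    finally show ?case .
  qed
  from this[OF order_refl] show ?thesis
    using assms by (auto simp: fun_eq_iff)
qed

context
  fixes n k :: nat and f :: "((nat \<Rightarrow> nat) \<Rightarrow> ('a \<Rightarrow> int)) \<Rightarrow> 'k::field"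
  assumes f: "f \<in> cochains G n k"
begin

lemma cochain_nonzero: "c \<in> carrier (K n k) \<Longrightarrow> f c \<noteq> 0"
  using f unfolding cochains_def module_Hom_def by (auto simp del: koszul_module_simps)

lemma cochain_add:
  assumes "c \<in> carrier (K n k)" and "d \<in> carrier (K n k)"
  shows "f (c \<oplus>\<^bsub>K n k\<^esub> d) = f c * f d"
  using f assms unfolding cochains_def module_Hom_def by (simp del: koszul_module_simps)

lemma cochain_smult:
  assumes "r \<in> carrier ZG" and "c \<in> carrier (K n k)"
  shows "f (r \<odot>\<^bsub>K n k\<^esub> c) = f c powi augmentation r"
  using f assms cochain_nonzero[OF assms(2)] unfolding cochains_def module_Hom_def
  by (simp del: koszul_module_simps)

lemma cochain_zero: "f \<zero>\<^bsub>K n k\<^esub> = 1"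
proof -
  have "f \<zero>\<^bsub>K n k\<^esub> * f \<zero>\<^bsub>K n k\<^esub> = f \<zero>\<^bsub>K n k\<^esub>"
    using cochain_add[OF K.zero_closed K.zero_closed] K.l_zero[OF K.zero_closed] by metis
  then show ?thesis using cochain_nonzero[OF K.zero_closed] by (metis mult_cancel_left2)
qed

lemma cochain_finsum:
  assumes "finite A" and "\<And>a. a \<in> A \<Longrightarrow> t a \<in> carrier (K n k)"
  shows "f (\<Oplus>\<^bsub>K n k\<^esub>a\<in>A. t a) = (\<Prod>a\<in>A. f (t a))"
  using assms
proof (induction A)
  case empty
  show ?case unfolding K.finsum_empty cochain_zero by simp
next
  case (insert a A)
  have "(\<Oplus>\<^bsub>K n k\<^esub>a\<in>insert a A. t a) = t a \<oplus>\<^bsub>K n k\<^esub> (\<Oplus>\<^bsub>K n k\<^esub>a\<in>A. t a)"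
    using insert by (intro K.finsum_insert) blast+
  moreover have "(\<Oplus>\<^bsub>K n k\<^esub>a\<in>A. t a) \<in> carrier (K n k)" and "t a \<in> carrier (K n k)"
    using insert.prems by (blast intro: K.finsum_closed)+
  ultimately show ?case
    using insert cochain_add by (simp del: koszul_module_simps)
qed

end

text \<open>The linear extension of a family of values on the generators. It reads \<open>F\<close> only at the
  sequences of degree \<open>k\<close>, so that families defined in all degrees may be used for \<open>F\<close>.\<close>
definition cochain_of ::
  "nat \<Rightarrow> nat \<Rightarrow> ((nat \<Rightarrow> nat) \<Rightarrow> 'k::field) \<Rightarrow> (((nat \<Rightarrow> nat) \<Rightarrow> ('a \<Rightarrow> int)) \<Rightarrow> 'k)" where
  "cochain_of n k F = (\<lambda>c\<in>carrier (K n k). \<Prod>a\<in>exponents n k. F a powi augmentation (c a))"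

lemma cochain_of_apply:
  "c \<in> carrier (K n k) \<Longrightarrow> cochain_of n k F c = (\<Prod>a\<in>exponents n k. F a powi augmentation (c a))"
  by (simp add: cochain_of_def)

lemma cochain_of_closed:
  assumes F: "\<And>a. a \<in> exponents n k \<Longrightarrow> F a \<noteq> 0"
  shows "cochain_of n k F \<in> cochains G n k"
  unfolding cochains_def module_Hom_def
proof (intro CollectI conjI ballI)
  show "cochain_of n k F \<in> carrier (K n k) \<rightarrow>\<^sub>E carrier units_module"
    unfolding cochain_of_def
    by (rule restrict_PiE_iff[THEN iffD2])
      (use F in \<open>auto simp: finite_exponents power_int_eq_0_iff simp del: koszul_module_simps\<close>)
next
  fix c d assume cd: "c \<in> carrier (K n k)" "d \<in> carrier (K n k)"
  then have "augmentation ((c \<oplus>\<^bsub>K n k\<^esub> d) a) = augmentation (c a) + augmentation (d a)" for a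
    using augmentation_add[of "c a" "d a"] by simp
  then show "cochain_of n k F (c \<oplus>\<^bsub>K n k\<^esub> d)
      = cochain_of n k F c \<oplus>\<^bsub>units_module\<^esub> cochain_of n k F d"
    using cd K.a_closed[OF cd] F
    by (simp add: cochain_of_apply power_int_add prod.distrib del: koszul_module_simps)
next
  fix r c assume rc: "r \<in> carrier ZG" "c \<in> carrier (K n k)"
  then have aug: "augmentation ((r \<odot>\<^bsub>K n k\<^esub> c) a) = augmentation (c a) * augmentation r" for a
    using augmentation_mult[of r "c a"] by simp
  have "cochain_of n k F c \<noteq> 0"
    using F rc by (simp add: cochain_of_apply finite_exponents power_int_eq_0_iff del: koszul_module_simps)
  then show "cochain_of n k F (r \<odot>\<^bsub>K n k\<^esub> c) = r \<odot>\<^bsub>units_module\<^esub> cochain_of n k F c"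
    using rc smult_closed[OF rc]
    by (simp add: cochain_of_apply aug power_int_mult prod_powi_bases del: koszul_module_simps)
qed

lemma cochain_of_Phi:
  assumes "a \<in> exponents n k"
  shows "cochain_of n k F (Phi G a) = F a"
proof -
  have "cochain_of n k F (Phi G a) = (\<Prod>b\<in>exponents n k. if b = a then F a else 1)"
    unfolding cochain_of_apply[OF Phi_closed[OF assms]]
    by (intro prod.cong) (auto simp: augmentation_Phi)
  then show ?thesis using assms by (simp add: finite_exponents)
qed

lemma cochain_of_cong:
  "(\<And>a. a \<in> exponents n k \<Longrightarrow> F a = F' a) \<Longrightarrow> cochain_of n k F = cochain_of n k F'"
  unfolding cochain_of_def by (intro restrict_ext prod.cong) auto

lemma cochain_of_eq_iff:
  "cochain_of n k F = cochain_of n k F' \<longleftrightarrow> (\<forall>a\<in>exponents n k. F a = F' a)"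
  using cochain_of_Phi cochain_of_cong by metis

text \<open>The default \<open>1\<close> in the other degrees makes the family nowhere zero and its coboundary trivial
  outside degree \<open>k + 1\<close>, so that identities of values can be stated for all sequences.\<close>
definition cochain_values ::
  "nat \<Rightarrow> nat \<Rightarrow> (((nat \<Rightarrow> nat) \<Rightarrow> ('a \<Rightarrow> int)) \<Rightarrow> 'k::field) \<Rightarrow> ((nat \<Rightarrow> nat) \<Rightarrow> 'k)" where
  "cochain_values n k f a = (if a \<in> exponents n k then f (Phi G a) else 1)"

lemma cochain_values_nonzero: "f \<in> cochains G n k \<Longrightarrow> cochain_values n k f a \<noteq> 0"
  using cochain_nonzero[of f n k, OF _ Phi_closed] by (simp add: cochain_values_def)

lemma cochain_of_cochain_values:
  fixes f :: "((nat \<Rightarrow> nat) \<Rightarrow> ('a \<Rightarrow> int)) \<Rightarrow> 'k::field"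
  assumes f: "f \<in> cochains G n k"
  shows "cochain_of n k (cochain_values n k f) = f"
proof
  fix c
  show "cochain_of n k (cochain_values n k f) c = f c"
  proof (cases "c \<in> carrier (K n k)")
    case True
    then have c: "c a \<in> carrier ZG" for a by simp
    have "f c = f (\<Oplus>\<^bsub>K n k\<^esub>a\<in>exponents n k. c a \<odot>\<^bsub>K n k\<^esub> Phi G a)"
      using koszul_module_expansion[OF True] by simp
    also have "\<dots> = (\<Prod>a\<in>exponents n k. f (c a \<odot>\<^bsub>K n k\<^esub> Phi G a))"
      by (rule cochain_finsum[OF f finite_exponents]) (rule smult_closed[OF c Phi_closed])
    also have "\<dots> = (\<Prod>a\<in>exponents n k. cochain_values n k f a powi augmentation (c a))"
      using cochain_smult[OF f c Phi_closed] by (intro prod.cong) (simp_all add: cochain_values_def)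
    finally show ?thesis using True by (simp add: cochain_of_apply)
  next
    case False
    moreover have "f \<in> carrier (K n k) \<rightarrow>\<^sub>E {x. x \<noteq> 0}"
      using f unfolding cochains_def module_Hom_def by (simp del: koszul_module_simps)
    ultimately show ?thesis
      using PiE_arb[of f] by (simp add: cochain_of_def del: koszul_module_simps)
  qed
qed

lemma decrement_in_exponents_iff:
  assumes "i \<in> {1..n}" and "b i \<noteq> 0"
  shows "decrement b i \<in> exponents n k \<longleftrightarrow> b \<in> exponents n (Suc k)"
proof -
  have "(\<Sum>j=1..n. b j) = b i + (\<Sum>j\<in>{1..n} - {i}. b j)"
    using assms by (intro sum.remove) auto
  moreover have "(\<Sum>j=1..n. decrement b i j) = decrement b i i + (\<Sum>j\<in>{1..n} - {i}. decrement b i j)"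
    using assms by (intro sum.remove) auto
  moreover have "(\<Sum>j\<in>{1..n} - {i}. decrement b i j) = (\<Sum>j\<in>{1..n} - {i}. b j)"
    by (intro sum.cong) (auto simp: decrement_def)
  ultimately have "(\<Sum>j=1..n. b j) = Suc (\<Sum>j=1..n. decrement b i j)"
    using assms by (simp add: decrement_def)
  moreover have "decrement b i j = b j" if "j \<notin> {1..n}" for j
    using assms(1) that by (auto simp: decrement_def)
  ultimately show ?thesis by (auto simp: exponents_def)
qed

lemma decrement_exponents:
  "b \<in> exponents n (Suc k) \<Longrightarrow> i \<in> {1..n} \<Longrightarrow> b i \<noteq> 0 \<Longrightarrow> decrement b i \<in> exponents n k"
  by (simp add: decrement_in_exponents_iff)

section \<open>Codifferential, cocycles and cohomologous cochains\<close>

context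
  fixes n :: nat and m :: "nat \<Rightarrow> nat" and g :: "nat \<Rightarrow> 'a"
  assumes g: "\<And>i. i \<in> {1..n} \<Longrightarrow> g i \<in> carrier G"
begin

lemma koszul_diff_gen_closed_apply:
  fixes f :: "((nat \<Rightarrow> nat) \<Rightarrow> ('a \<Rightarrow> int)) \<Rightarrow> 'k::field"
  assumes f: "f \<in> cochains G n k" and b: "b \<in> exponents n (Suc k)" and i: "i \<in> {1..n}"
  shows "koszul_diff_gen G n m g (Suc k) i b \<in> carrier (K n k)"
    and "f (koszul_diff_gen G n m g (Suc k) i b) =
      (if i \<in> norm_positions n b
       then cochain_values n k f (decrement b i) powi (koszul_sign b i * int (m i)) else 1)"
proof -
  let ?s = "(\<ominus>\<^bsub>ZG\<^esub> \<one>\<^bsub>ZG\<^esub>) [^]\<^bsub>ZG\<^esub> (\<Sum>l=1..<i. b l)"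
  let ?x = "if even (b i) then N_elt G (m i) (g i) else T_elt G (g i)"
  have one: "\<one>\<^bsub>ZG\<^esub> \<in> carrier ZG" by simp
  have s: "?s \<in> carrier ZG" "augmentation ?s = koszul_sign b i"
    using group_ring_pow_closed[OF ZG.a_inv_closed[OF one]] augmentation_pow[OF ZG.a_inv_closed[OF one]]
      augmentation_uminus[OF one] by (simp_all add: koszul_sign_def)
  have x: "?x \<in> carrier ZG" "augmentation ?x = (if even (b i) then int (m i) else 0)"
    using g[OF i] by (simp_all add: N_elt_closed T_elt_closed augmentation_N_elt augmentation_T_elt)
  have sx: "?s \<otimes>\<^bsub>ZG\<^esub> ?x \<in> carrier ZG"
    "augmentation (?s \<otimes>\<^bsub>ZG\<^esub> ?x) = koszul_sign b i * (if even (b i) then int (m i) else 0)"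
    using group_ring_mult_closed[OF s(1) x(1)] augmentation_mult[OF s(1) x(1)]
    unfolding s(2) x(2) by blast+
  show "koszul_diff_gen G n m g (Suc k) i b \<in> carrier (K n k)"
  proof (cases "b i = 0")
    case True
    show ?thesis
      unfolding koszul_diff_gen_def diff_Suc_1 if_P[OF True] by (rule K.zero_closed)
  next
    case False
    then show ?thesis
      unfolding koszul_diff_gen_def diff_Suc_1 if_not_P[OF False]
      using decrement_exponents[OF b i False]
      by (intro smult_closed sx(1) Phi_closed) (simp add: decrement_def)
  qed
  show "f (koszul_diff_gen G n m g (Suc k) i b) =
      (if i \<in> norm_positions n b
       then cochain_values n k f (decrement b i) powi (koszul_sign b i * int (m i)) else 1)"
  proof (cases "b i = 0")
    case True
    then show ?thesis
      unfolding koszul_diff_gen_def diff_Suc_1 if_P[OF True] cochain_zero[OF f]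
      by (simp add: norm_positions_def)
  next
    case False
    have dec: "decrement b i \<in> exponents n k" by (rule decrement_exponents[OF b i False])
    have "f (koszul_diff_gen G n m g (Suc k) i b)
        = f (Phi G (decrement b i)) powi augmentation (?s \<otimes>\<^bsub>ZG\<^esub> ?x)"
      unfolding koszul_diff_gen_def diff_Suc_1 if_not_P[OF False] decrement_def[symmetric]
      by (rule cochain_smult[OF f sx(1) Phi_closed[OF dec]])
    then show ?thesis
      unfolding sx(2) using dec False i by (simp add: norm_positions_def cochain_values_def)
  qed
qed

text \<open>Both sides are determined by their values on the generators, where the augmentations \<open>m\<^sub>i\<close> of \<open>N\<^sub>i\<close>
  and \<open>0\<close> of \<open>T\<^sub>i\<close> turn the differential into the formula for \<open>coboundary_values\<close>.\<close>
lemma codiff_eq_cochain_of: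
  fixes f :: "((nat \<Rightarrow> nat) \<Rightarrow> ('a \<Rightarrow> int)) \<Rightarrow> 'k::field"
  assumes f: "f \<in> cochains G n k"
  shows "codiff G n m g (Suc k) f
    = cochain_of n (Suc k) (coboundary_values n m (cochain_values n k f))"
  unfolding codiff_def cochain_of_def
proof (rule restrict_ext)
  fix c assume c: "c \<in> carrier (K n (Suc k))"
  then have ca: "c b \<in> carrier ZG" for b by simp
  let ?d = "\<lambda>b. \<Oplus>\<^bsub>K n k\<^esub>i\<in>{1..n}. koszul_diff_gen G n m g (Suc k) i b"
  have gen: "koszul_diff_gen G n m g (Suc k) i b \<in> carrier (K n k)"
    if "b \<in> exponents n (Suc k)" "i \<in> {1..n}" for b i
    using that by (rule koszul_diff_gen_closed_apply(1)[OF f])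
  then have d: "?d b \<in> carrier (K n k)" if "b \<in> exponents n (Suc k)" for b
    using that by (blast intro: K.finsum_closed)
  have fd: "f (?d b) = coboundary_values n m (cochain_values n k f) b" if b: "b \<in> exponents n (Suc k)" for b
  proof -
    have "f (?d b) = (\<Prod>i\<in>{1..n}. f (koszul_diff_gen G n m g (Suc k) i b))"
      using gen[OF b] by (intro cochain_finsum[OF f]) auto
    also have "\<dots> = (\<Prod>i\<in>{1..n}. if i \<in> norm_positions n b
        then cochain_values n k f (decrement b i) powi (koszul_sign b i * int (m i)) else 1)"
      by (intro prod.cong refl koszul_diff_gen_closed_apply(2)[OF f b])
    also have "\<dots> = coboundary_values n m (cochain_values n k f) b"
      unfolding coboundary_values_def
      by (rule prod.mono_neutral_cong_right) (auto simp: norm_positions_def)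
    finally show ?thesis .
  qed
  have "f (koszul_diff G n m g (Suc k) c) = (\<Prod>b\<in>exponents n (Suc k). f (c b \<odot>\<^bsub>K n k\<^esub> ?d b))"
    unfolding koszul_diff_def diff_Suc_1
    by (rule cochain_finsum[OF f finite_exponents]) (rule smult_closed[OF ca d])
  also have "\<dots> = (\<Prod>b\<in>exponents n (Suc k).
      coboundary_values n m (cochain_values n k f) b powi augmentation (c b))"
    using cochain_smult[OF f ca d] fd by (intro prod.cong refl) simp
  finally show "f (koszul_diff G n m g (Suc k) c) = (\<Prod>b\<in>exponents n (Suc k).
      coboundary_values n m (cochain_values n k f) b powi augmentation (c b))" .
qed

lemma cocycles_iff:
  fixes f :: "((nat \<Rightarrow> nat) \<Rightarrow> ('a \<Rightarrow> int)) \<Rightarrow> 'k::field"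
  assumes f: "f \<in> cochains G n k"
  shows "f \<in> cocycles G n m g k \<longleftrightarrow>
    (\<forall>b\<in>exponents n (Suc k). coboundary_values n m (cochain_values n k f) b = 1)"
proof -
  have "(\<lambda>c\<in>carrier (K n (Suc k)). 1) = (cochain_of n (Suc k) (\<lambda>a. 1)
      :: ((nat \<Rightarrow> nat) \<Rightarrow> ('a \<Rightarrow> int)) \<Rightarrow> 'k)"
    by (simp add: cochain_of_def)
  then show ?thesis
    using f by (simp add: cocycles_def codiff_eq_cochain_of cochain_of_eq_iff del: koszul_module_simps)
qed

lemma cochain_divide:
  fixes f f' :: "((nat \<Rightarrow> nat) \<Rightarrow> ('a \<Rightarrow> int)) \<Rightarrow> 'k::field"
  assumes f: "f \<in> cochains G n k" and f': "f' \<in> cochains G n k"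
  shows "(\<lambda>c\<in>carrier (K n k). f c / f' c)
    = cochain_of n k (\<lambda>a. cochain_values n k f a / cochain_values n k f' a)"
  unfolding cochain_of_def
  by (subst cochain_of_cochain_values[OF f, symmetric], subst cochain_of_cochain_values[OF f', symmetric])
    (simp add: cochain_of_def power_int_divide_distrib prod_dividef cong: restrict_cong del: koszul_module_simps)

lemma cohomologous_iff:
  fixes f f' :: "((nat \<Rightarrow> nat) \<Rightarrow> ('a \<Rightarrow> int)) \<Rightarrow> 'k::field"
  assumes f: "f \<in> cochains G n (Suc k)" and f': "f' \<in> cochains G n (Suc k)"
  shows "cohomologous G n m g (Suc k) f f' \<longleftrightarrow>
    (\<exists>h\<in>cochains G n k. \<forall>a\<in>exponents n (Suc k).
       cochain_values n (Suc k) f a / cochain_values n (Suc k) f' a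
         = coboundary_values n m (cochain_values n k h) a)"
  unfolding cohomologous_def coboundaries_def cochain_divide[OF f f'] diff_Suc_1
  by (auto simp: codiff_eq_cochain_of cochain_of_eq_iff image_iff)

end

end


section \<open>Exponent sequences by their nonzero entries\<close>

lemma
  assumes mono: "strict_mono_on {1..l} r"
  shows power_exponents_at: "i \<in> {1..l} \<Longrightarrow> power_exponents l r lam (r i) = lam i"
    and power_exponents_off: "j \<notin> r ` {1..l} \<Longrightarrow> power_exponents l r lam j = 0"
proof -
  show "power_exponents l r lam (r i) = lam i" if "i \<in> {1..l}"
  proof -
    have single: "{i'. i' \<in> {1..l} \<and> r i' = r i} = {i}"
      using that strict_mono_on_imp_inj_on[OF mono] by (auto dest: inj_onD)
    show ?thesis unfolding power_exponents_def single by simp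
  qed
  show "power_exponents l r lam j = 0" if "j \<notin> r ` {1..l}"
  proof -
    have empty: "{i. i \<in> {1..l} \<and> r i = j} = {}" using that by blast
    show ?thesis unfolding power_exponents_def empty by simp
  qed
qed

text \<open>The first of the positions \<open>r\<^sub>1 < \<dots> < r\<^sub>l\<close> is the leading one, so that the parity of \<open>\<lambda>\<^sub>1\<close> in the
  normalization condition is the parity of the leading entry.\<close>
lemma power_exponents_props:
  assumes l: "1 \<le> l" and mono: "strict_mono_on {1..l} r" and r: "r ` {1..l} \<subseteq> {1..n}"
    and lam: "\<forall>i\<in>{1..l}. 1 \<le> lam i" and sum: "(\<Sum>i=1..l. lam i) = k"
  shows "power_exponents l r lam \<in> exponents n k"
    and "leads n (power_exponents l r lam) (r 1)"
proof -
  have "(\<Sum>j=1..n. power_exponents l r lam j) = k"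
    unfolding power_exponents_def using sum.group[OF _ _ r, of lam] sum by simp
  moreover have "power_exponents l r lam j = 0" if "j \<notin> {1..n}" for j
    using that r by (intro power_exponents_off[OF mono]) blast
  ultimately show "power_exponents l r lam \<in> exponents n k"
    by (simp add: exponents_def)
  have "j \<notin> r ` {1..l}" if j: "j < r 1" for j
  proof
    assume "j \<in> r ` {1..l}"
    then obtain i where i: "i \<in> {1..l}" "j = r i" by blast
    then have "r 1 \<le> r i"
      using l mono by (intro strict_mono_on_leD[OF mono]) auto
    with i j show False by simp
  qed
  moreover have one: "1 \<in> {1..l}" using l by simp
  moreover have "r 1 \<in> {1..n}" and "lam 1 \<noteq> 0"
    using r one bspec[OF lam one] by (blast, linarith)
  moreover have "power_exponents l r lam (r 1) = lam 1"
    by (rule power_exponents_at[OF mono one])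
  ultimately show "leads n (power_exponents l r lam) (r 1)"
    using power_exponents_off[OF mono] unfolding leads_def by (metis atLeastLessThan_iff)
qed

text \<open>The positions \<open>r\<^sub>i\<close> enumerate the support of the sequence in increasing order; a leading position
  exists only if this support is nonempty.\<close>
lemma exponents_as_power_exponents:
  assumes a: "a \<in> exponents n k" and p: "leads n a p"
  obtains l r lam where "1 \<le> l" and "strict_mono_on {1..l} r" and "r ` {1..l} \<subseteq> {1..n}"
    and "\<forall>i\<in>{1..l}. 1 \<le> lam i" and "(\<Sum>i=1..l. lam i) = k"
    and "power_exponents l r lam = a" and "r 1 = p"
proof -
  define S where "S = {j. a j \<noteq> 0}"
  have S: "S \<subseteq> {1..n}" using a by (auto simp: S_def exponents_def)
  then have fin: "finite S" using finite_subset by blast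
  obtain h where h: "bij_betw h {..<card S} S" "strict_mono_on {..<card S} h"
    using ex_bij_betw_strict_mono_card[OF fin] by blast
  define r where "r i = h (i - 1)" for i
  define lam where "lam i = a (r i)" for i
  let ?l = "card S"
  have "p \<in> S" using p by (simp add: leads_def S_def)
  then have l: "1 \<le> ?l" using fin by (metis One_nat_def Suc_leI card_gt_0_iff empty_iff)
  have mono: "strict_mono_on {1..?l} r"
    unfolding r_def by (intro strict_mono_onI strict_mono_onD[OF h(2)]) auto
  have "(\<lambda>i. i - 1) ` {1..?l} = {..<?l}"
  proof (intro equalityI subsetI)
    fix x assume "x \<in> {..<?l}"
    then show "x \<in> (\<lambda>i. i - 1) ` {1..?l}" by (intro image_eqI[of _ _ "Suc x"]) auto
  qed auto
  then have image: "r ` {1..?l} = S"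
    using h(1) unfolding bij_betw_def r_def by (metis image_image)
  have lam: "\<forall>i\<in>{1..?l}. 1 \<le> lam i"
    using image by (auto simp: lam_def S_def Suc_le_eq)
  have eq: "power_exponents ?l r lam = a"
  proof
    fix j show "power_exponents ?l r lam j = a j"
    proof (cases "j \<in> S")
      case True
      then obtain i where "i \<in> {1..?l}" "j = r i" using image by blast
      then show ?thesis using power_exponents_at[OF mono, of i lam] lam_def[of i] by metis
    next
      case False
      then show ?thesis using power_exponents_off[OF mono, of j lam] image by (simp add: S_def)
    qed
  qed
  have "(\<Sum>i=1..?l. lam i) = (\<Sum>j\<in>S. a j)"
    using sum.reindex[OF strict_mono_on_imp_inj_on[OF mono], of a] image
    by (simp add: lam_def comp_def)
  also have "\<dots> = (\<Sum>j=1..n. a j)"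
    using S by (intro sum.mono_neutral_left) (auto simp: S_def)
  also have "\<dots> = k" using a by (simp add: exponents_def)
  finally have sum: "(\<Sum>i=1..?l. lam i) = k" .
  have "leads n (power_exponents ?l r lam) (r 1)"
    using image S by (intro power_exponents_props(2)[OF l mono _ lam sum]) simp
  then have "r 1 = p" using p leads_unique unfolding eq by blast
  with l mono lam sum eq image S show ?thesis using that by metis
qed

section \<open>Normalized cochains represent the cohomology\<close>

context monoid
begin

text \<open>At odd leading entries, being a power of \<open>\<zeta>\<close> is the equation \<open>x ^ m\<^sub>p = 1\<close>. This removes both
  the roots of unity and the enumeration of supports from the normalization condition.\<close>
lemma normalized_cochains_iff:
  fixes f :: "((nat \<Rightarrow> nat) \<Rightarrow> ('a \<Rightarrow> int)) \<Rightarrow> 'k::field"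
  assumes \<zeta>: "\<And>i. i \<in> {1..n} \<Longrightarrow> primitive_root_of_unity (m i) (\<zeta> (m i))"
    and f: "f \<in> cochains G n k"
  shows "f \<in> normalized_cochains G n m \<zeta> k \<longleftrightarrow>
    (\<forall>a p. leads n a p \<longrightarrow> cochain_values n k f a ^ m p = 1
       \<and> (even (a p) \<longrightarrow> cochain_values n k f a = 1))"
    (is "_ \<longleftrightarrow> ?torsion")
proof
  assume N: "f \<in> normalized_cochains G n m \<zeta> k"
  show ?torsion
  proof (intro allI impI)
    fix a p assume p: "leads n a p"
    show "cochain_values n k f a ^ m p = 1 \<and> (even (a p) \<longrightarrow> cochain_values n k f a = 1)"
    proof (cases "a \<in> exponents n k")
      case True
      then obtain l r lam where lrl: "1 \<le> l" "strict_mono_on {1..l} r" "r ` {1..l} \<subseteq> {1..n}"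
        "\<forall>i\<in>{1..l}. 1 \<le> lam i" "(\<Sum>i=1..l. lam i) = k"
        and eq: "power_exponents l r lam = a" and r1: "r 1 = p"
        using exponents_as_power_exponents p by metis
      then have "lam 1 = a p"
        using power_exponents_at[OF lrl(2), of 1 lam] by simp
      moreover have "(even (lam 1) \<longrightarrow> f (Phi G a) = 1) \<and>
          (odd (lam 1) \<longrightarrow> (\<exists>e<m (r 1). f (Phi G a) = \<zeta> (m (r 1)) ^ e))"
        using N lrl eq unfolding normalized_cochains_def by blast
      ultimately show ?thesis
        using power_eq_1_iff_power_of_primitive_root[OF \<zeta>[of p], of "f (Phi G a)"] p True r1
        by (cases "even (a p)") (auto simp: cochain_values_def leads_def)
    next
      case False
      then show ?thesis by (simp add: cochain_values_def)
    qed
  qed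
next
  assume T: ?torsion
  have "(even (lam 1) \<longrightarrow> f (Phi G (power_exponents l r lam)) = 1) \<and>
      (odd (lam 1) \<longrightarrow> (\<exists>e<m (r 1). f (Phi G (power_exponents l r lam)) = \<zeta> (m (r 1)) ^ e))"
    if lrl: "1 \<le> l" "strict_mono_on {1..l} r" "r ` {1..l} \<subseteq> {1..n}"
      "\<forall>i\<in>{1..l}. 1 \<le> lam i" "(\<Sum>i=1..l. lam i) = k" for l r lam
  proof -
    let ?a = "power_exponents l r lam"
    have a: "?a \<in> exponents n k" and lead: "leads n ?a (r 1)"
      using power_exponents_props[OF lrl] by blast+
    moreover have "?a (r 1) = lam 1"
      using lrl(1) by (intro power_exponents_at[OF lrl(2)]) simp
    moreover have "r 1 \<in> {1..n}" using lead by (simp add: leads_def)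
    moreover have "cochain_values n k f ?a ^ m (r 1) = 1
        \<and> (even (?a (r 1)) \<longrightarrow> cochain_values n k f ?a = 1)"
      using T lead by blast
    ultimately show ?thesis
      using power_eq_1_iff_power_of_primitive_root[OF \<zeta>[of "r 1"], of "f (Phi G ?a)"]
      by (auto simp: cochain_values_def)
  qed
  then show "f \<in> normalized_cochains G n m \<zeta> k"
    using f unfolding normalized_cochains_def by blast
qed

text \<open>The group ring enters the cohomology only through augmentations. So the statement is
  one about the graded family of values alone and holds over any monoid \<open>G\<close> and for any elements
  \<open>g\<^sub>i\<close> of it.\<close>
theorem normalized_cochains_represent_cohomology:
  fixes \<zeta> :: "nat \<Rightarrow> 'k::alg_closed_field"
  assumes g: "\<And>i. i \<in> {1..n} \<Longrightarrow> g i \<in> carrier G"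
    and m: "\<And>i. i \<in> {1..n} \<Longrightarrow> m i \<ge> 1"
    and chain: "\<And>i j. 1 \<le> i \<Longrightarrow> i \<le> j \<Longrightarrow> j \<le> n \<Longrightarrow> m i dvd m j"
    and \<zeta>: "\<And>i. i \<in> {1..n} \<Longrightarrow> primitive_root_of_unity (m i) (\<zeta> (m i))"
  shows "complete_set_of_representatives (normalized_cochains G n m \<zeta> (Suc k))
    (cocycles G n m g (Suc k)) (cohomologous G n m g (Suc k))"
    (is "complete_set_of_representatives ?S ?Z ?R")
proof -
  let ?V = "cochain_values n (Suc k) :: (((nat \<Rightarrow> nat) \<Rightarrow> ('a \<Rightarrow> int)) \<Rightarrow> 'k) \<Rightarrow> _"
  let ?D = "coboundary_values n m :: ((nat \<Rightarrow> nat) \<Rightarrow> 'k) \<Rightarrow> _"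
  have S_iff: "f \<in> ?S \<longleftrightarrow> (\<forall>a p. leads n a p \<longrightarrow> ?V f a ^ m p = 1 \<and> (even (a p) \<longrightarrow> ?V f a = 1))"
    if "f \<in> cochains G n (Suc k)" for f
    by (rule normalized_cochains_iff[OF _ that]) (fact \<zeta>)
  have Z_iff: "f \<in> ?Z \<longleftrightarrow> (\<forall>b\<in>exponents n (Suc (Suc k)). ?D (?V f) b = 1)"
    if "f \<in> cochains G n (Suc k)" for f
    by (rule cocycles_iff[OF _ that]) (fact g)
  have R_iff: "?R f f' \<longleftrightarrow> (\<exists>h\<in>cochains G n k. \<forall>a\<in>exponents n (Suc k).
      ?V f a / ?V f' a = ?D (cochain_values n k h) a)"
    if "f \<in> cochains G n (Suc k)" "f' \<in> cochains G n (Suc k)" for f f'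
    by (rule cohomologous_iff[OF _ that]) (fact g)
  have S_cochain: "f \<in> cochains G n (Suc k)" if "f \<in> ?S" for f
    using that by (simp add: normalized_cochains_def)
  have Z_cochain: "f \<in> cochains G n (Suc k)" if "f \<in> ?Z" for f
    using that by (simp add: cocycles_def)
  have off_degree: "?D (cochain_values n j f) b = 1" if "b \<notin> exponents n (Suc j)" for j b
    and f :: "((nat \<Rightarrow> nat) \<Rightarrow> ('a \<Rightarrow> int)) \<Rightarrow> 'k"
    using that decrement_in_exponents_iff
    by (auto simp: coboundary_values_def norm_positions_def cochain_values_def intro!: prod.neutral)
  have subset: "?S \<subseteq> ?Z"
  proof
    fix f assume f: "f \<in> ?S"
    then have "?D (?V f) b = 1" for b
      using coboundary_values_torsion[of n m "?V f" b] chain S_iff[OF S_cochain[OF f]] by blast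
    then show "f \<in> ?Z" using Z_iff[OF S_cochain[OF f]] by blast
  qed
  have ex: "\<exists>f'\<in>?S. ?R f f'" if fZ: "f \<in> ?Z" for f
  proof -
    note f = Z_cochain[OF fZ]
    obtain L where L: "\<And>a. L a \<noteq> 0"
      "\<And>a p. leads n a p \<Longrightarrow> even (a p) \<Longrightarrow> ?D L a = ?V f a"
      using coboundary_prescribed_at_even_leads[of n m "?V f"] m cochain_values_nonzero[OF f] by metis
    define F' where "F' = (\<lambda>a. ?V f a / ?D L a)"
    have DL: "?D L a \<noteq> 0" for a by (rule coboundary_values_nonzero[OF L(1)])
    have F'0: "F' a \<noteq> 0" for a using cochain_values_nonzero[OF f] DL by (simp add: F'_def)
    have F'1: "F' a = 1" if "leads n a p" "even (a p)" for a p
      using L(2)[OF that] DL[of a] by (simp add: F'_def)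
    have "?D (?V f) b = 1" for b
      using Z_iff[OF f] fZ off_degree by blast
    then have "?D F' b = 1" for b
      by (simp add: F'_def coboundary_values_divide coboundary_values_coboundary_values L(1))
    then have tors: "F' a ^ m p = 1" if "leads n a p" for a p
      using torsion_of_even_lead_coboundary[of n F' m a p] F'1 that by blast
    define f' where "f' = (cochain_of n (Suc k) F' :: ((nat \<Rightarrow> nat) \<Rightarrow> ('a \<Rightarrow> int)) \<Rightarrow> 'k)"
    define h where "h = (cochain_of n k L :: ((nat \<Rightarrow> nat) \<Rightarrow> ('a \<Rightarrow> int)) \<Rightarrow> 'k)"
    have f': "f' \<in> cochains G n (Suc k)" unfolding f'_def using F'0 by (rule cochain_of_closed)
    have h: "h \<in> cochains G n k" unfolding h_def using L(1) by (rule cochain_of_closed)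
    have Vf': "?V f' a = (if a \<in> exponents n (Suc k) then F' a else 1)" for a
      by (simp add: cochain_values_def f'_def cochain_of_Phi)
    have "f' \<in> ?S"
      using S_iff[OF f'] tors F'1 by (simp add: Vf')
    moreover have "?V f a / ?V f' a = ?D (cochain_values n k h) a" if a: "a \<in> exponents n (Suc k)" for a
    proof -
      \<comment> \<open>In degree \<open>k + 1\<close> the coboundary reads \<open>L\<close> only in degree \<open>k\<close>, where \<open>h\<close> has the values of \<open>L\<close>.\<close>
      have "?D (cochain_values n k h) a = ?D L a"
        unfolding coboundary_values_def using decrement_exponents[OF a]
        by (intro prod.cong refl) (auto simp: cochain_values_def h_def cochain_of_Phi norm_positions_def)
      then show ?thesis
        using a cochain_values_nonzero[OF f, of a] by (simp add: Vf' F'_def)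
    qed
    then have "?R f f'" using R_iff[OF f f'] h by blast
    ultimately show ?thesis by blast
  qed
  have uniq: "f1 = f2" if f: "f \<in> ?Z" and f1: "f1 \<in> ?S" "?R f f1" and f2: "f2 \<in> ?S" "?R f f2" for f f1 f2
  proof -
    note c = Z_cochain[OF f] S_cochain[OF f1(1)] S_cochain[OF f2(1)]
    obtain h1 h2 where h: "h1 \<in> cochains G n k" "h2 \<in> cochains G n k"
      and h1: "\<And>a. a \<in> exponents n (Suc k) \<Longrightarrow> ?V f a / ?V f1 a = ?D (cochain_values n k h1) a"
      and h2: "\<And>a. a \<in> exponents n (Suc k) \<Longrightarrow> ?V f a / ?V f2 a = ?D (cochain_values n k h2) a"
      using f1(2) f2(2) R_iff[OF c(1,2)] R_iff[OF c(1,3)] by blast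
    define H where "H = (\<lambda>a. cochain_values n k h1 a / cochain_values n k h2 a)"
    have H0: "H a \<noteq> 0" for a 
      using cochain_values_nonzero[OF h(1)] cochain_values_nonzero[OF h(2)] by (simp add: H_def)
    have DH: "?D H a = ?V f2 a / ?V f1 a" for a
    proof (cases "a \<in> exponents n (Suc k)")
      case True
      then show ?thesis
        using cochain_values_nonzero[OF c(1), of a]
        by (simp add: H_def coboundary_values_divide flip: h1 h2)
    next
      case False
      then show ?thesis
        by (simp add: H_def coboundary_values_divide off_degree) (simp add: cochain_values_def)
    qed
    have "?D H b = 1" if "leads n b p" "even (b p)" for b p
      using that S_iff[OF c(2)] S_iff[OF c(3)] f1(1) f2(1) by (simp add: DH)
    then have "?D H a = 1" for a
      using coboundary_trivial_if_trivial_at_even_leads[of n m H a] m chain H0 by blast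
    then have "?V f2 a = ?V f1 a" for a
      using DH[of a] cochain_values_nonzero[OF c(2), of a] by simp
    then have "?V f2 = ?V f1" by blast
    then show ?thesis
      using cochain_of_cochain_values[OF c(2)] cochain_of_cochain_values[OF c(3)] by simp
  qed
  show ?thesis
    unfolding complete_set_of_representatives_def using subset ex uniq by blast
qed

end

theorem theorem2p1:
  fixes n k :: nat
    and m :: "nat \<Rightarrow> nat"
    and \<gamma> :: "nat \<Rightarrow> int"
    and \<zeta> :: "nat \<Rightarrow> 'k::{alg_closed_field, field_char_0}"
  assumes "\<And>i. i \<in> {1..n} \<Longrightarrow> m i \<ge> 1"
    and "\<And>i. 1 \<le> i \<Longrightarrow> i < n \<Longrightarrow> m i dvd m (i + 1)"
    and "\<And>i. i \<in> {1..n} \<Longrightarrow> \<gamma> i \<in> carrier (integer_mod_group (m i))"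
    and "\<And>i. i \<in> {1..n} \<Longrightarrow>
           subgroup_generated (integer_mod_group (m i)) {\<gamma> i} = integer_mod_group (m i)"
    and "\<And>i. i \<in> {1..n} \<Longrightarrow> primitive_root_of_unity (m i) (\<zeta> (m i))"
    and "k \<ge> 1"
  shows "complete_set_of_representatives
           (normalized_cochains (cyclic_product n m) n m \<zeta> k)
           (cocycles (cyclic_product n m) n m (factor_elt n m \<gamma>) k)
           (cohomologous (cyclic_product n m) n m (factor_elt n m \<gamma>) k)"
proof -
  have "group (cyclic_product n m)"
    unfolding cyclic_product_def by (intro product_group) simp
  then have G: "monoid (cyclic_product n m)" by (rule group.is_monoid)
  have g: "factor_elt n m \<gamma> i \<in> carrier (cyclic_product n m)" if "i \<in> {1..n}" for i
  proof -
    have "\<one>\<^bsub>integer_mod_group (m j)\<^esub> \<in> carrier (integer_mod_group (m j))" for j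
      using group.is_monoid[OF group_integer_mod_group] by (rule monoid.one_closed)
    then show ?thesis
      using assms(3)[OF that] by (auto simp: cyclic_product_def factor_elt_def)
  qed
  have chain: "m i dvd m j" if "1 \<le> i" "i \<le> j" "j \<le> n" for i j
    using that(2,3)
  proof (induction j rule: dec_induct)
    case (step j)
    then show ?case using assms(2)[of j] \<open>1 \<le> i\<close> by (auto intro: dvd_trans)
  qed simp
  obtain k' where "k = Suc k'" using assms(6) by (cases k) auto
  show ?thesis
    unfolding \<open>k = Suc k'\<close>
    by (rule monoid.normalized_cochains_represent_cohomology[OF G])
      (fact g, fact assms(1), fact chain, fact assms(5))
qed

end
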